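(* Let $n \geq 1$ be an integer and let $P \in \mathbf C[z_1^{\pm1},\dots,z_n^{\pm1}]$ be a Laurent polynomial with $k = k(P) \geq 2$ non-zero coefficients. Let $\kappa = \kappa(P)$. Then for every $\alpha \in (0,1)$ and every $r > 0$, \[ \mu_n(S(P,r)) \leq C_1(n,k)\cdot \alpha^{1-n}\left(\frac{r}{L_\infty(P)}\right)^{\frac{1-\alpha}{\kappa-1}}, \] where $C_1(n,k) := 6k\cdot(18nk^2)^{n-1}$.
   Context: $\mathbf T^n = \{z \in \mathbf C^n : |z_i| = 1\ \forall i\}$ and $\mu_n$ is the probability Haar measure on it. Writing $P = \sum_{v\in\mathbf Z^n} c_v z^v$: $k(P)$ is the number of non-zero $c_v$; $L_\infty(P) := \max_v |c_v|$; for each $i$, $k_i(P)$ is the number of non-zero coefficients of $P$ viewed as a Laurent polynomial in $z_i$ (with coefficients in the other variables), and $\kappa(P) := \max_{1\leq i\leq n} k_i(P)$. For $r \geq 0$, $S(P,r) := \{z \in \mathbf T^n : |P(z)| \leq r\}$. *)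

theory Defs
  imports "HOL-Probability.Probability" "HOL-Library.Poly_Mapping"
begin

(* A Laurent polynomial is an element of the group algebra of the exponent group:
   the exponent of a monomial is a finitely supported map from variable indices to int.
   The variables z_1, ..., z_n are indexed by 0, ..., n - 1. *)
type_synonym laurent = "(nat \<Rightarrow>\<^sub>0 int) \<Rightarrow>\<^sub>0 complex"

definition laurent_polys :: "nat \<Rightarrow> laurent set" where
  "laurent_polys n = {P. \<forall>v\<in>Poly_Mapping.keys P. Poly_Mapping.keys v \<subseteq> {..<n}}"

definition laurent_eval :: "nat \<Rightarrow> laurent \<Rightarrow> (nat \<Rightarrow> complex) \<Rightarrow> complex" where
  "laurent_eval n P z = (\<Sum>v\<in>Poly_Mapping.keys P. Poly_Mapping.lookup P v * (\<Prod>i<n. z i powi Poly_Mapping.lookup v i))"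

definition num_coeffs :: "laurent \<Rightarrow> nat" where
  "num_coeffs P = card {v. Poly_Mapping.lookup P v \<noteq> 0}"

definition L_inf :: "laurent \<Rightarrow> real" where
  "L_inf P = Max (range (\<lambda>v. cmod (Poly_Mapping.lookup P v)))"

(* The coefficient of z_i^m in P, a Laurent polynomial in the remaining variables. *)
definition coeff_in :: "nat \<Rightarrow> laurent \<Rightarrow> int \<Rightarrow> laurent" where
  "coeff_in i P m = (\<Sum>v | v \<in> Poly_Mapping.keys P \<and> Poly_Mapping.lookup v i = m.
     Poly_Mapping.single (v - Poly_Mapping.single i m) (Poly_Mapping.lookup P v))"

definition num_coeffs_in :: "nat \<Rightarrow> laurent \<Rightarrow> nat" where
  "num_coeffs_in i P = card {m. coeff_in i P m \<noteq> 0}"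

definition kappa :: "nat \<Rightarrow> laurent \<Rightarrow> nat" where
  "kappa n P = Max ((\<lambda>i. num_coeffs_in i P) ` {..<n})"

definition torus :: "nat \<Rightarrow> (nat \<Rightarrow> complex) set" where
  "torus n = {..<n} \<rightarrow>\<^sub>E {z. cmod z = 1}"

definition circle_borel :: "complex measure" where
  "circle_borel = restrict_space borel {z. cmod z = 1}"

definition circle_measure :: "complex measure" where
  "circle_measure = distr (uniform_measure lborel {0..<1}) circle_borel (\<lambda>t. cis (2 * pi * t))"

(* The probability Haar measure, constructed as a product of circle measures; the theorem
   is_haar_prob_iff below shows that it is the only translation-invariant Borel probability
   measure on the torus. *)
definition torus_measure :: "nat \<Rightarrow> (nat \<Rightarrow> complex) measure" where
  "torus_measure n = PiM {..<n} (\<lambda>_. circle_measure)"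

definition sublevel :: "nat \<Rightarrow> laurent \<Rightarrow> real \<Rightarrow> (nat \<Rightarrow> complex) set" where
  "sublevel n P r = {z \<in> torus n. cmod (laurent_eval n P z) \<le> r}"

definition C1 :: "nat \<Rightarrow> nat \<Rightarrow> real" where
  "C1 n k = 6 * real k * (18 * real n * real k ^ 2) ^ (n - 1)"

lemma coeff_in_expansion:
  "P = (\<Sum>m\<in>(\<lambda>v. Poly_Mapping.lookup v i) ` Poly_Mapping.keys P. Poly_Mapping.single (Poly_Mapping.single i m) 1 * coeff_in i P m)"
proof -
  have P: "(\<Sum>v\<in>Poly_Mapping.keys P. Poly_Mapping.single v (Poly_Mapping.lookup P v)) = P"
    by (intro poly_mapping_eqI)
       (auto simp: lookup_sum lookup_single when_def not_in_keys_iff_lookup_eq_zero)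
  have "Poly_Mapping.single (Poly_Mapping.single i m) 1 * coeff_in i P m =
      (\<Sum>v | v \<in> Poly_Mapping.keys P \<and> Poly_Mapping.lookup v i = m. Poly_Mapping.single v (Poly_Mapping.lookup P v))" for m
    by (simp add: coeff_in_def sum_distrib_left mult_single)
  then have "(\<Sum>m\<in>(\<lambda>v. Poly_Mapping.lookup v i) ` Poly_Mapping.keys P.
      Poly_Mapping.single (Poly_Mapping.single i m) 1 * coeff_in i P m) =
      (\<Sum>v\<in>Poly_Mapping.keys P. Poly_Mapping.single v (Poly_Mapping.lookup P v))"
    using sum.image_gen[of "Poly_Mapping.keys P" "\<lambda>v. Poly_Mapping.single v (Poly_Mapping.lookup P v)" "\<lambda>v. Poly_Mapping.lookup v i"]
    by simp
  then show ?thesis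
    unfolding P by (rule sym)
qed

lemma lookup_coeff_in:
  "Poly_Mapping.lookup (coeff_in i P m) w = (if Poly_Mapping.lookup w i = 0 then Poly_Mapping.lookup P (w + Poly_Mapping.single i m) else 0)"
proof -
  have "Poly_Mapping.lookup (coeff_in i P m) w =
      (\<Sum>v | v \<in> Poly_Mapping.keys P \<and> Poly_Mapping.lookup v i = m. if v = w + Poly_Mapping.single i m then Poly_Mapping.lookup P v else 0)"
    unfolding coeff_in_def lookup_sum
    by (intro sum.cong) (auto simp: lookup_single when_def)
  also have "\<dots> = (if Poly_Mapping.lookup w i = 0 then Poly_Mapping.lookup P (w + Poly_Mapping.single i m) else 0)"
    by (subst sum.delta) (auto simp: lookup_add in_keys_iff)
  finally show ?thesis .
qed

(* The product sigma-algebra is the Borel sigma-algebra, the circle being second countable. *)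
definition torus_borel :: "nat \<Rightarrow> (nat \<Rightarrow> complex) measure" where
  "torus_borel n = PiM {..<n} (\<lambda>_. circle_borel)"

definition torus_mult :: "nat \<Rightarrow> (nat \<Rightarrow> complex) \<Rightarrow> (nat \<Rightarrow> complex) \<Rightarrow> nat \<Rightarrow> complex" where
  "torus_mult n w z = (\<lambda>i\<in>{..<n}. w i * z i)"

definition is_haar_prob :: "nat \<Rightarrow> (nat \<Rightarrow> complex) measure \<Rightarrow> bool" where
  "is_haar_prob n M \<longleftrightarrow> prob_space M \<and> sets M = sets (torus_borel n) \<and>
     (\<forall>w\<in>torus n. distr M M (torus_mult n w) = M)"

lemma space_circle_borel [simp]: "space circle_borel = {z. cmod z = 1}"
  by (simp add: circle_borel_def space_restrict_space)

lemma space_torus_borel [simp]: "space (torus_borel n) = torus n"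
  by (simp add: torus_borel_def torus_def space_PiM)

lemma measurable_cis_circle [measurable]: "(\<lambda>t. cis (2 * pi * t)) \<in> borel \<rightarrow>\<^sub>M circle_borel"
  unfolding circle_borel_def
  by (rule measurable_restrict_space2)
     (auto intro!: borel_measurable_continuous_onI continuous_intros)

lemma measurable_circle_ident [measurable]: "(\<lambda>z. z) \<in> circle_borel \<rightarrow>\<^sub>M borel"
  unfolding circle_borel_def by (rule measurable_restrict_space1) simp

lemma sets_circle_measure [measurable_cong, simp]: "sets circle_measure = sets circle_borel"
  by (simp add: circle_measure_def)

lemma space_circle_measure [simp]: "space circle_measure = {z. cmod z = 1}"
  by (simp add: circle_measure_def)

lemma prob_space_circle_measure: "prob_space circle_measure"
  unfolding circle_measure_def
  by (intro prob_space.prob_space_distr prob_space_uniform_measure) auto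

lemma sets_torus_measure [measurable_cong, simp]: "sets (torus_measure n) = sets (torus_borel n)"
  unfolding torus_measure_def torus_borel_def by (intro sets_PiM_cong) auto

lemma space_torus_measure [simp]: "space (torus_measure n) = torus n"
  using sets_eq_imp_space_eq[OF sets_torus_measure] by simp

lemma prob_space_torus_measure: "prob_space (torus_measure n)"
  unfolding torus_measure_def by (intro prob_space_PiM prob_space_circle_measure)

lemma emeasure_circle_measure:
  assumes "A \<in> sets circle_borel"
  shows "emeasure circle_measure A = emeasure lborel {t\<in>{0..<1}. cis (2 * pi * t) \<in> A}"
proof -
  have "(\<lambda>t. cis (2 * pi * t)) -` A \<in> sets borel"
    using measurable_sets[OF measurable_cis_circle assms] by simp
  moreover have "{0..<1} \<inter> (\<lambda>t. cis (2 * pi * t)) -` A = {t\<in>{0..<1}. cis (2 * pi * t) \<in> A}"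
    by auto
  moreover have "(\<lambda>t. cis (2 * pi * t)) \<in> uniform_measure lborel {0..<1} \<rightarrow>\<^sub>M circle_borel"
    using measurable_cis_circle by (simp cong: measurable_cong_sets)
  ultimately show ?thesis
    unfolding circle_measure_def by (simp add: emeasure_distr assms divide_ennreal_def)
qed

lemma circle_mult_measurable:
  "cmod w = 1 \<Longrightarrow> (\<lambda>z. w * z) \<in> circle_borel \<rightarrow>\<^sub>M circle_borel"
  unfolding circle_borel_def
  by (intro measurable_restrict_space2 measurable_restrict_space1)
     (auto simp: space_restrict_space norm_mult)

lemma emeasure_lborel_shift:
  assumes [measurable]: "B \<in> sets borel"
  shows "emeasure lborel {t::real. t + c \<in> B} = emeasure lborel B"
proof -
  have "emeasure lborel B = emeasure (distr lborel borel ((+) c)) B"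
    by (simp add: lborel_distr_plus)
  also have "\<dots> = emeasure lborel {t. t + c \<in> B}"
    by (subst emeasure_distr) (auto simp: vimage_def add.commute)
  finally show ?thesis by simp
qed

lemma circle_measure_invariant:
  assumes w: "cmod w = 1"
  shows "distr circle_measure circle_measure (\<lambda>z. w * z) = circle_measure"
proof (rule measure_eqI)
  fix A assume "A \<in> sets (distr circle_measure circle_measure (\<lambda>z. w * z))"
  then have A: "A \<in> sets circle_borel" by simp
  define s where "s = frac (Arg w / (2 * pi))"
  have s: "0 \<le> s" "s < 1" by (auto simp: s_def frac_lt_1)
  have ws: "w = cis (2 * pi * s)"
  proof -
    have "2 * pi * s = Arg w - 2 * pi * of_int \<lfloor>Arg w / (2 * pi)\<rfloor>"
      by (simp add: s_def frac_def field_simps)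
    then have "cis (2 * pi * s) = cis (Arg w)"
      by (simp add: cis_divide[symmetric])
    then show ?thesis
      using w by (metis cis_Arg div_by_1 norm_zero of_real_1 sgn_eq zero_neq_one)
  qed
  define B where "B = {t. cis (2 * pi * t) \<in> A}"
  have B [measurable]: "B \<in> sets borel"
    using measurable_sets[OF measurable_cis_circle A] by (simp add: B_def vimage_def)
  have per: "t + 1 \<in> B \<longleftrightarrow> t \<in> B" for t
    by (simp add: B_def ring_distribs cis_mult[symmetric])
  have wA: "(\<lambda>z. w * z) -` A \<inter> {z. cmod z = 1} \<in> sets circle_borel"
    using measurable_sets[OF circle_mult_measurable[OF w] A] by simp
  have "emeasure (distr circle_measure circle_measure (\<lambda>z. w * z)) A
      = emeasure circle_measure ((\<lambda>z. w * z) -` A \<inter> {z. cmod z = 1})"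
    using A circle_mult_measurable[OF w] by (subst emeasure_distr) (auto cong: measurable_cong_sets)
  also have "\<dots> = emeasure lborel {t. t + s \<in> B \<inter> {s..<s + 1}}"
    by (subst emeasure_circle_measure[OF wA], rule arg_cong[where f = "emeasure lborel"])
       (auto simp: B_def ws cis_mult ring_distribs add.commute)
  also have "\<dots> = emeasure lborel (B \<inter> {s..<s + 1})"
    by (rule emeasure_lborel_shift) simp
  also have "B \<inter> {s..<s + 1} = (B \<inter> {s..<1}) \<union> (B \<inter> {1..<s + 1})"
    using s by auto
  also have "emeasure lborel \<dots> = emeasure lborel (B \<inter> {s..<1}) + emeasure lborel (B \<inter> {1..<s + 1})"
    by (rule plus_emeasure[symmetric]) auto
  also have "emeasure lborel (B \<inter> {1..<s + 1}) = emeasure lborel {t. t + 1 \<in> B \<inter> {1..<s + 1}}"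
    by (rule emeasure_lborel_shift[symmetric]) simp
  also have "{t. t + 1 \<in> B \<inter> {1..<s + 1}} = B \<inter> {0..<s}"
    by (auto simp: per)
  also have "emeasure lborel (B \<inter> {s..<1}) + emeasure lborel (B \<inter> {0..<s})
      = emeasure lborel ((B \<inter> {s..<1}) \<union> (B \<inter> {0..<s}))"
    by (rule plus_emeasure) auto
  also have "(B \<inter> {s..<1}) \<union> (B \<inter> {0..<s}) = {t\<in>{0..<1}. cis (2 * pi * t) \<in> A}"
    using s by (auto simp: B_def)
  finally show "emeasure (distr circle_measure circle_measure (\<lambda>z. w * z)) A = emeasure circle_measure A"
    using emeasure_circle_measure[OF A] by simp
qed simp

lemma is_haar_prob_torus_measure: "is_haar_prob n (torus_measure n)"
proof -
  have "distr (torus_measure n) (torus_measure n) (torus_mult n w) = torus_measure n"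
    if w: "w \<in> torus n" for w
  proof -
    interpret product_sigma_finite "\<lambda>_. circle_measure"
      using prob_space_circle_measure
      by (intro product_sigma_finite.intro) (simp add: prob_space_imp_sigma_finite)
    have w1: "i < n \<Longrightarrow> cmod (w i) = 1" for i
      using w by (auto simp: torus_def PiE_def Pi_def)
    have m: "(\<lambda>z. w i * z) \<in> circle_measure \<rightarrow>\<^sub>M circle_measure" if "i < n" for i
      using circle_mult_measurable[OF w1[OF that]] by (simp cong: measurable_cong_sets)
    have mult: "torus_mult n w \<in> torus_measure n \<rightarrow>\<^sub>M torus_measure n"
      unfolding torus_measure_def torus_mult_def
    proof (rule measurable_restrict)
      fix i assume i: "i \<in> {..<n}"
      have "(\<lambda>z. z i) \<in> PiM {..<n} (\<lambda>_. circle_measure) \<rightarrow>\<^sub>M circle_measure"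
        using i by (rule measurable_component_singleton)
      then show "(\<lambda>z. w i * z i) \<in> PiM {..<n} (\<lambda>_. circle_measure) \<rightarrow>\<^sub>M circle_measure"
        by (rule measurable_compose) (use i m in simp)
    qed
    show ?thesis
      unfolding torus_measure_def
    proof (rule PiM_eqI)
      fix A assume A: "\<And>i. i \<in> {..<n} \<Longrightarrow> A i \<in> sets circle_measure"
      let ?A = "\<lambda>i. (\<lambda>z. w i * z) -` A i \<inter> space circle_measure"
      have A': "?A i \<in> sets circle_measure" if "i < n" for i
        using measurable_sets[OF m[OF that] A] that by simp
      have "torus_mult n w -` (Pi\<^sub>E {..<n} A) \<inter> torus n = Pi\<^sub>E {..<n} ?A"
        by (auto simp: torus_mult_def torus_def PiE_def Pi_def)
      then have "emeasure (distr (torus_measure n) (torus_measure n) (torus_mult n w)) (Pi\<^sub>E {..<n} A)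
          = emeasure (torus_measure n) (Pi\<^sub>E {..<n} ?A)"
        using mult sets_PiM_I_finite[OF finite_lessThan A]
        by (subst emeasure_distr) (auto simp: torus_measure_def[symmetric])
      also have "\<dots> = (\<Prod>i<n. emeasure circle_measure (?A i))"
        unfolding torus_measure_def using A' by (intro emeasure_PiM) auto
      also have "\<dots> = (\<Prod>i<n. emeasure circle_measure (A i))"
      proof (rule prod.cong)
        fix i assume "i \<in> {..<n}"
        then show "emeasure circle_measure (?A i) = emeasure circle_measure (A i)"
          using emeasure_distr[OF m A, of i] circle_measure_invariant[OF w1, of i] by simp
      qed simp
      finally show "emeasure (distr (PiM {..<n} (\<lambda>_. circle_measure)) (PiM {..<n} (\<lambda>_. circle_measure))
          (torus_mult n w)) (Pi\<^sub>E {..<n} A) = (\<Prod>i<n. emeasure circle_measure (A i))"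
        by (simp add: torus_measure_def)
    qed simp_all
  qed
  then show ?thesis
    by (simp add: is_haar_prob_def prob_space_torus_measure)
qed

lemma torus_mult_measurable:
  "(\<lambda>(w, z). torus_mult n w z) \<in> torus_borel n \<Otimes>\<^sub>M torus_borel n \<rightarrow>\<^sub>M torus_borel n"
  unfolding torus_mult_def torus_borel_def split_beta
proof (rule measurable_restrict)
  fix i assume i: "i \<in> {..<n}"
  let ?M = "PiM {..<n} (\<lambda>_. circle_borel)"
  have c: "(\<lambda>z. z i) \<in> ?M \<rightarrow>\<^sub>M circle_borel"
    using i by (rule measurable_component_singleton)
  have [measurable]: "(\<lambda>z. z i) \<in> ?M \<rightarrow>\<^sub>M borel"
    using measurable_compose[OF c measurable_circle_ident] .
  have "(\<lambda>x. fst x i * snd x i) \<in> ?M \<Otimes>\<^sub>M ?M \<rightarrow>\<^sub>M borel"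
    by measurable
  then show "(\<lambda>x. fst x i * snd x i) \<in> ?M \<Otimes>\<^sub>M ?M \<rightarrow>\<^sub>M circle_borel"
    using i unfolding circle_borel_def
    by (intro measurable_restrict_space2)
       (auto simp: space_pair_measure space_PiM norm_mult PiE_def Pi_def space_restrict_space)
qed

theorem is_haar_prob_iff: "is_haar_prob n M \<longleftrightarrow> M = torus_measure n"
proof
  assume M: "is_haar_prob n M"
  let ?T = "torus_measure n"
  interpret M: prob_space M using M by (simp add: is_haar_prob_def)
  interpret T: prob_space ?T by (rule prob_space_torus_measure)
  interpret pair_sigma_finite M ?T ..
  have sM [measurable_cong]: "sets M = sets (torus_borel n)"
    using M by (simp add: is_haar_prob_def)
  then have spM: "space M = torus n"
    using sets_eq_imp_space_eq[of M "torus_borel n"] by simp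
  have inv: "(\<integral>\<^sup>+z. indicator A (torus_mult n w z) \<partial>N) = emeasure N A"
    if N: "is_haar_prob n N" and A: "A \<in> sets (torus_borel n)" and w: "w \<in> torus n" for N A w
  proof -
    have sN: "sets N = sets (torus_borel n)" and d: "distr N N (torus_mult n w) = N"
      using N w by (auto simp: is_haar_prob_def)
    have m: "torus_mult n w \<in> N \<rightarrow>\<^sub>M N"
      using measurable_Pair2[OF torus_mult_measurable, of w n] w sN
      by (simp cong: measurable_cong_sets)
    have "emeasure N A = (\<integral>\<^sup>+z. indicator A z \<partial>distr N N (torus_mult n w))"
      using A sN d by simp
    also have "\<dots> = (\<integral>\<^sup>+z. indicator A (torus_mult n w z) \<partial>N)"
      using A sN by (intro nn_integral_distr m) auto
    finally show ?thesis by simp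
  qed
  show "M = ?T"
  proof (rule measure_eqI)
    fix A assume "A \<in> sets M"
    then have A [measurable]: "A \<in> sets (torus_borel n)" using sM by simp
    have comm: "torus_mult n w z = torus_mult n z w" for w z
      by (simp add: torus_mult_def mult.commute)
    note [measurable] = torus_mult_measurable[unfolded split_beta]
    have meas: "(\<lambda>(x, y). indicator A (torus_mult n x y) :: ennreal) \<in> borel_measurable (M \<Otimes>\<^sub>M ?T)"
      unfolding split_beta by measurable
    have "emeasure ?T A = (\<integral>\<^sup>+x. emeasure ?T A \<partial>M)"
      by (simp add: M.emeasure_space_1)
    also have "\<dots> = (\<integral>\<^sup>+x. \<integral>\<^sup>+y. indicator A (torus_mult n x y) \<partial>?T \<partial>M)"
      by (intro nn_integral_cong) (simp add: inv[OF is_haar_prob_torus_measure A] spM)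
    also have "\<dots> = (\<integral>\<^sup>+y. \<integral>\<^sup>+x. indicator A (torus_mult n x y) \<partial>M \<partial>?T)"
      using Fubini[OF meas] by simp
    also have "\<dots> = (\<integral>\<^sup>+y. emeasure M A \<partial>?T)"
      by (intro nn_integral_cong) (subst comm, simp add: inv[OF M A])
    also have "\<dots> = emeasure M A"
      using T.emeasure_space_1 by simp
    finally show "emeasure M A = emeasure ?T A" by simp
  qed (simp add: sM)
qed (simp add: is_haar_prob_torus_measure)

lemma sublevel_measurable: "sublevel n P r \<in> sets (torus_measure n)"
proof -
  have [measurable]: "(\<lambda>z. z i powi k) \<in> borel_measurable (torus_borel n)" if i: "i < n" for i k
  proof -
    have "(\<lambda>z. z i) \<in> torus_borel n \<rightarrow>\<^sub>M circle_borel"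
      unfolding torus_borel_def using i by (intro measurable_component_singleton) simp
    from measurable_compose[OF this measurable_circle_ident]
    have [measurable]: "(\<lambda>z. z i) \<in> borel_measurable (torus_borel n)" .
    show ?thesis
      by (cases "k \<ge> 0") (simp_all add: power_int_def)
  qed
  have [measurable]: "laurent_eval n P \<in> borel_measurable (torus_borel n)"
    unfolding laurent_eval_def by (intro borel_measurable_sum borel_measurable_times borel_measurable_prod) auto
  have "{z \<in> space (torus_borel n). cmod (laurent_eval n P z) \<le> r} \<in> sets (torus_borel n)"
    by measurable
  then show ?thesis by (simp add: sublevel_def)
qed

end

theory Submission
  imports Defs
begin

text \<open>
  For one variable, let \<open>c\<^sub>j\<close> be a non-zero coefficient and multiply by a monomial so that the exponent
  farthest from \<open>j\<close> becomes \<open>0\<close>. Differentiation then kills one of the \<open>k\<close> terms, and after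
  division by \<open>D = \<bar>j\<bar>\<close> the coefficient \<open>c\<^sub>j\<close> keeps its modulus while all frequencies are at most \<open>2D\<close>.
  Where the normalised derivative is at least \<open>\<delta>\<close>, the real or the imaginary part of the polynomial
  moves with speed of order \<open>D\<delta>\<close> and is monotone between at most \<open>4D\<close> critical points, so this
  part contributes at most \<open>6r/\<delta>\<close>, independently of \<open>D\<close>; elsewhere induction on the number of terms
  applies. For \<open>\<bar>c\<^sub>j\<bar> = 1\<close>, choosing \<open>\<delta> = r\<^bsup>(k-2)/(k-1)\<^esup>\<close> makes both contributions of order \<open>r\<^bsup>1/(k-1)\<^esup>\<close>.

  For several variables, apply this bound in the last variable to the coefficient \<open>Q\<close>, a Laurent
  polynomial in the others, that contains a largest coefficient of \<open>P\<close>. By Fubini the measure is at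
  most \<open>6\<kappa>\<close> times the integral of \<open>min 1 ((r/\<bar>Q\<bar>)\<^bsup>1/(\<kappa>-1)\<^esup>)\<close>, and inserting the inductive bound for
  the distribution of \<open>\<bar>Q\<bar>\<close> into the layer cake formula costs a factor \<open>1/\<alpha>\<close> and keeps the exponent.
\<close>

subsection \<open>Sublevel sets away from critical points\<close>

definition steep_sublevel ::
  "(real \<Rightarrow> 'a::real_normed_vector) \<Rightarrow> (real \<Rightarrow> 'a) \<Rightarrow> real \<Rightarrow> real \<Rightarrow> real set \<Rightarrow> real set" where
  "steep_sublevel g g' r s I = {t\<in>I. norm (g t) \<le> r \<and> s \<le> norm (g' t)}"

lemma compact_steep_sublevel:
  assumes "continuous_on {a..b} g" "continuous_on {a..b} g'"
  shows "compact (steep_sublevel g g' r s {a..b})"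
proof -
  have "closed ({t\<in>{a..b}. norm (g t) \<le> r} \<inter> {t\<in>{a..b}. s \<le> norm (g' t)})"
    using assms by (intro closed_Int continuous_on_closed_Collect_le continuous_intros) auto
  moreover have "steep_sublevel g g' r s {a..b} =
      {a..b} \<inter> ({t\<in>{a..b}. norm (g t) \<le> r} \<inter> {t\<in>{a..b}. s \<le> norm (g' t)})"
    by (auto simp: steep_sublevel_def)
  ultimately show ?thesis
    by (simp only: compact_Int_closed compact_Icc)
qed

lemma measure_steep_sublevel_split:
  assumes z: "z \<in> {a..b}" and cont: "continuous_on {a..b} g" "continuous_on {a..b} g'"
  shows "measure lborel (steep_sublevel g g' r s {a..b}) \<le>
    measure lborel (steep_sublevel g g' r s {a..z}) + measure lborel (steep_sublevel g g' r s {z..b})"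
proof -
  have "steep_sublevel g g' r s {a..b} = steep_sublevel g g' r s {a..z} \<union> steep_sublevel g g' r s {z..b}"
    using z by (auto simp: steep_sublevel_def)
  moreover have "steep_sublevel g g' r s {c..d} \<in> sets lborel" if "{c..d} \<subseteq> {a..b}" for c d
    unfolding sets_lborel
    by (intro borel_compact compact_steep_sublevel continuous_on_subset[OF cont(1) that]
        continuous_on_subset[OF cont(2) that])
  ultimately show ?thesis
    using z by (simp add: measure_Un_le)
qed

lemma mult_measure_le_increment:
  fixes g g' :: "real \<Rightarrow> real"
  assumes "a \<le> b" and E: "compact E" "E \<subseteq> {a..b}"
    and deriv: "\<And>t. t \<in> {a..b} \<Longrightarrow> (g has_real_derivative g' t) (at t within {a..b})"
    and nonneg: "\<And>t. t \<in> {a..b} \<Longrightarrow> 0 \<le> g' t" and large: "\<And>t. t \<in> E \<Longrightarrow> s \<le> g' t"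
  shows "s * measure lborel E \<le> g b - g a"
proof (rule has_integral_le)
  have "((\<lambda>t. 1) has_integral measure lborel E) E"
    using E(1)
    by (intro has_integral_measure_lborel borel_compact emeasure_bounded_finite compact_imp_bounded)
  then show "((\<lambda>t. if t \<in> E then s else 0) has_integral s * measure lborel E) {a..b}"
    using has_integral_mult_right[of "\<lambda>t. 1" _ E s] E(2) by (simp add: has_integral_restrict)
  show "(g' has_integral g b - g a) {a..b}"
    using assms(1) deriv
    by (intro fundamental_theorem_of_calculus) (simp_all flip: has_real_derivative_iff_has_vector_derivative)
  show "(if t \<in> E then s else 0) \<le> g' t" if "t \<in> {a..b}" for t
    using nonneg large that by simp
qed

lemma measure_steep_sublevel_mono_le:
  fixes g g' :: "real \<Rightarrow> real"
  assumes deriv: "\<And>t. t \<in> {a..b} \<Longrightarrow> (g has_real_derivative g' t) (at t within {a..b})"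
    and cont: "continuous_on {a..b} g'"
    and nonneg: "\<And>t. t \<in> {a..b} \<Longrightarrow> 0 \<le> g' t"
    and r: "0 \<le> r" and s: "0 < s"
  shows "measure lborel (steep_sublevel g g' r s {a..b}) \<le> 2 * r / s" (is "measure lborel ?E \<le> _")
proof (cases "?E = {}")
  case True
  then show ?thesis
    using r s by simp
next
  case False
  have "compact ?E"
    using DERIV_continuous_on[OF deriv] cont by (rule compact_steep_sublevel)
  then obtain u v where u: "u \<in> ?E" "\<And>t. t \<in> ?E \<Longrightarrow> u \<le> t" and v: "v \<in> ?E" "\<And>t. t \<in> ?E \<Longrightarrow> t \<le> v"
    using compact_attains_inf[of ?E] compact_attains_sup[of ?E] False by blast
  have uv: "u \<le> v" "{u..v} \<subseteq> {a..b}" "?E \<subseteq> {u..v}"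
    using u v by (auto simp: steep_sublevel_def)
  have "s * measure lborel ?E \<le> g v - g u"
  proof (rule mult_measure_le_increment[OF uv(1) \<open>compact ?E\<close> uv(3)])
    show "(g has_real_derivative g' t) (at t within {u..v})" if "t \<in> {u..v}" for t
      using that uv(2) by (intro has_field_derivative_subset[OF deriv]) auto
    show "0 \<le> g' t" if "t \<in> {u..v}" for t
      using that uv(2) nonneg by auto
    show "s \<le> g' t" if "t \<in> ?E" for t
      using that nonneg[of t] by (simp add: steep_sublevel_def)
  qed
  also have "\<dots> \<le> 2 * r"
    using u(1) v(1) by (auto simp: steep_sublevel_def)
  finally show ?thesis
    using s by (simp add: field_simps)
qed

lemma nonneg_or_nonpos_if_no_zero_inside:
  fixes f :: "real \<Rightarrow> real"
  assumes cont: "continuous_on {a..b} f" and nz: "\<And>t. t \<in> {a<..<b} \<Longrightarrow> f t \<noteq> 0"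
  shows "(\<forall>t\<in>{a..b}. 0 \<le> f t) \<or> (\<forall>t\<in>{a..b}. 0 \<le> - f t)"
proof (rule ccontr)
  assume "\<not> ?thesis"
  then obtain u v where u: "u \<in> {a..b}" "f u < 0" and v: "v \<in> {a..b}" "0 < f v"
    by (auto simp: not_le)
  have "closed_segment u v \<subseteq> {a..b}"
    using u v by (intro closed_segment_subset) auto
  moreover have "0 \<in> closed_segment (f u) (f v)"
    using u v by (simp add: closed_segment_eq_real_ivl)
  ultimately obtain x where x: "x \<in> closed_segment u v" "f x = 0"
    using IVT'_closed_segment_real continuous_on_subset[OF cont] by blast
  then have "x \<noteq> u" "x \<noteq> v"
    using u v by auto
  then show False
    using nz[of x] x u v by (auto simp: closed_segment_eq_real_ivl split: if_splits)
qed

lemma measure_steep_sublevel_no_zero_le: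
  fixes g g' :: "real \<Rightarrow> real"
  assumes deriv: "\<And>t. t \<in> {a..b} \<Longrightarrow> (g has_real_derivative g' t) (at t within {a..b})"
    and cont: "continuous_on {a..b} g'"
    and nz: "\<And>t. t \<in> {a<..<b} \<Longrightarrow> g' t \<noteq> 0"
    and rs: "0 \<le> r" "0 < s"
  shows "measure lborel (steep_sublevel g g' r s {a..b}) \<le> 2 * r / s"
  using nonneg_or_nonpos_if_no_zero_inside[OF cont nz]
proof
  assume "\<forall>t\<in>{a..b}. 0 \<le> g' t"
  then show ?thesis
    by (intro measure_steep_sublevel_mono_le deriv cont rs) auto
next
  assume "\<forall>t\<in>{a..b}. 0 \<le> - g' t"
  then have "measure lborel (steep_sublevel (\<lambda>t. - g t) (\<lambda>t. - g' t) r s {a..b}) \<le> 2 * r / s"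
    by (intro measure_steep_sublevel_mono_le DERIV_minus deriv continuous_on_minus cont rs) auto
  then show ?thesis
    by (simp add: steep_sublevel_def)
qed

lemma measure_steep_sublevel_le:
  fixes g g' :: "real \<Rightarrow> real"
  assumes "finite Z"
    and "\<And>t. t \<in> {a..b} \<Longrightarrow> (g has_real_derivative g' t) (at t within {a..b})"
    and "continuous_on {a..b} g'"
    and "\<And>t. t \<in> {a<..<b} \<Longrightarrow> g' t = 0 \<Longrightarrow> t \<in> Z"
    and rs: "0 \<le> r" "0 < s"
  shows "measure lborel (steep_sublevel g g' r s {a..b}) \<le> (real (card Z) + 1) * (2 * r / s)"
  using assms(1-4)
proof (induction Z arbitrary: b rule: finite_linorder_max_induct)
  case (empty b)
  then show ?case
    using measure_steep_sublevel_no_zero_le[of a b g g' r s] rs by auto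
next
  case (insert z Z b)
  let ?\<mu> = "\<lambda>c d. measure lborel (steep_sublevel g g' r s {c..d})"
  have card: "(real (card (insert z Z)) + 1) * (2 * r / s) = (real (card Z) + 1) * (2 * r / s) + 2 * r / s"
    using insert.hyps rs by (subst card_insert_disjoint) (auto simp: field_simps)
  show ?case
  proof (cases "z \<in> {a<..<b}")
    case False
    then have "?\<mu> a b \<le> (real (card Z) + 1) * (2 * r / s)"
      using insert.prems by (intro insert.IH) auto
    then show ?thesis
      unfolding card using rs by (intro add_increasing2) auto
  next
    case True
    note restrict = has_field_derivative_subset[OF insert.prems(1)] continuous_on_subset[OF insert.prems(2)]
    have left: "?\<mu> a z \<le> (real (card Z) + 1) * (2 * r / s)"
    proof (rule insert.IH)
      show "t \<in> Z" if "t \<in> {a<..<z}" "g' t = 0" for t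
        using that True insert.prems(3)[of t] by auto
    qed (use True in \<open>auto intro!: restrict\<close>)
    have right: "?\<mu> z b \<le> 2 * r / s"
    proof (rule measure_steep_sublevel_no_zero_le[OF _ _ _ rs])
      show "g' t \<noteq> 0" if "t \<in> {z<..<b}" for t
        using that True insert.prems(3)[of t] insert.hyps by force
    qed (use True in \<open>auto intro!: restrict\<close>)
    have "?\<mu> a b \<le> ?\<mu> a z + ?\<mu> z b"
      using True DERIV_continuous_on[OF insert.prems(1)] insert.prems(2)
      by (intro measure_steep_sublevel_split) auto
    then show ?thesis
      unfolding card using left right by linarith
  qed
qed

subsection \<open>Trigonometric polynomials\<close>

definition trig_poly :: "(int \<Rightarrow> complex) \<Rightarrow> int set \<Rightarrow> real \<Rightarrow> complex" where
  "trig_poly c A t = (\<Sum>m\<in>A. c m * cis (2 * pi * of_int m * t))"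

definition deriv_coeff :: "(int \<Rightarrow> complex) \<Rightarrow> int \<Rightarrow> complex" where
  "deriv_coeff c m = 2 * pi * \<i> * of_int m * c m"

definition trig_sublevel :: "(int \<Rightarrow> complex) \<Rightarrow> int set \<Rightarrow> real \<Rightarrow> real set" where
  "trig_sublevel c A r = {t\<in>{0..1}. cmod (trig_poly c A t) \<le> r}"

lemma continuous_on_trig_poly [continuous_intros]: "continuous_on S (trig_poly c A)"
  unfolding trig_poly_def by (intro continuous_intros)

lemma borel_measurable_trig_poly [measurable]: "trig_poly c A \<in> borel_measurable borel"
  by (intro borel_measurable_continuous_onI continuous_intros)

lemma has_vector_derivative_trig_poly:
  "(trig_poly c A has_vector_derivative trig_poly (deriv_coeff c) A t) (at t within S)"
  unfolding trig_poly_def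
proof (rule has_vector_derivative_sum)
  fix m
  have "((\<lambda>t. cis (2 * pi * of_int m * t)) has_vector_derivative
      2 * pi * \<i> * of_int m * cis (2 * pi * of_int m * t)) (at t within S)"
    unfolding has_vector_derivative_def
    by (rule derivative_eq_intros refl | simp add: fun_eq_iff scaleR_conv_of_real)+
  from has_vector_derivative_mult_right[OF this, of "c m"]
  show "((\<lambda>t. c m * cis (2 * pi * of_int m * t)) has_vector_derivative
      deriv_coeff c m * cis (2 * pi * of_int m * t)) (at t within S)"
    by (simp only: deriv_coeff_def mult_ac)
qed

lemma trig_poly_cmult: "trig_poly (\<lambda>m. a * c m) A t = a * trig_poly c A t"
  by (simp add: trig_poly_def sum_distrib_left mult.assoc)

lemma deriv_coeff_cmult: "deriv_coeff (\<lambda>m. a * c m) = (\<lambda>m. a * deriv_coeff c m)"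
  by (simp add: deriv_coeff_def fun_eq_iff)

lemma Im_trig_poly: "Im (trig_poly c A t) = Re (trig_poly (\<lambda>m. - \<i> * c m) A t)"
  unfolding trig_poly_cmult by simp

lemma trig_poly_shift:
  "trig_poly (\<lambda>m. c (m + i)) ((\<lambda>m. m - i) ` A) t = cis (- (2 * pi * of_int i * t)) * trig_poly c A t"
proof -
  have shift: "cis (2 * pi * of_int (m - i) * t) = cis (- (2 * pi * of_int i * t)) * cis (2 * pi * of_int m * t)"
    for m
    by (simp add: cis_mult algebra_simps)
  have inj: "inj_on (\<lambda>m. m - i) A"
    by (simp add: inj_on_def)
  show ?thesis
    unfolding trig_poly_def sum.reindex[OF inj] o_def shift sum_distrib_left by (simp add: mult_ac)
qed

lemma fmeasurable_Collect_Icc: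
  fixes a b :: real
  assumes [measurable]: "Measurable.pred borel P"
  shows "{t\<in>{a..b}. P t} \<in> fmeasurable lborel"
proof (rule fmeasurableI2[of "{a..b}"])
  show "{a..b} \<in> fmeasurable lborel"
    by (simp add: fmeasurable_def emeasure_lborel_Icc_eq)
  show "{t\<in>{a..b}. P t} \<in> sets lborel"
    unfolding sets_lborel by measurable
qed auto

lemma fmeasurable_steep_sublevel:
  assumes [measurable]: "g \<in> borel_measurable borel" "g' \<in> borel_measurable borel"
  shows "steep_sublevel g g' r s {a..b} \<in> fmeasurable lborel"
  unfolding steep_sublevel_def by (intro fmeasurable_Collect_Icc) measurable

lemma fmeasurable_trig_sublevel: "trig_sublevel c A r \<in> fmeasurable lborel"
  unfolding trig_sublevel_def by (intro fmeasurable_Collect_Icc) measurable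

lemma measure_trig_sublevel_le_1: "measure lborel (trig_sublevel c A r) \<le> 1"
proof -
  have "measure lborel (trig_sublevel c A r) \<le> measure lborel {0..1::real}"
    using fmeasurable_trig_sublevel
    by (intro measure_mono_fmeasurable fmeasurableD) (auto simp: trig_sublevel_def fmeasurable_def)
  then show ?thesis by simp
qed

lemma trig_sublevel_monomial: "r < cmod (c j) \<Longrightarrow> trig_sublevel c {j} r = {}"
  by (auto simp: trig_sublevel_def trig_poly_def norm_mult)

lemma inj_on_cis_2pi: "inj_on (\<lambda>t. cis (2 * pi * t)) {0..<1}"
proof (rule inj_onI)
  fix s t :: real
  assume st: "s \<in> {0..<1}" "t \<in> {0..<1}" and eq: "cis (2 * pi * s) = cis (2 * pi * t)"
  have "\<bar>s - t\<bar> < 1"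
    using st by (auto simp: abs_less_iff)
  then have "\<bar>2 * pi * (s - t)\<bar> < 2 * pi"
    by (simp add: abs_mult)
  then have "\<bar>2 * pi * s - 2 * pi * t\<bar> < 2 * pi"
    by (simp only: right_diff_distrib)
  moreover have "exp (\<i> * of_real (2 * pi * s)) = exp (\<i> * of_real (2 * pi * t))"
    using eq by (simp only: cis_conv_exp)
  ultimately have "\<i> * of_real (2 * pi * s) = \<i> * of_real (2 * pi * t)"
    using exp_complex_eqI[of "\<i> * of_real (2 * pi * s)" "\<i> * of_real (2 * pi * t)"]
    by (simp only: Im_i_times Re_complex_of_real)
  then show "s = t" by simp
qed

lemma card_poly_roots_on_circle:
  fixes p :: "complex poly"
  assumes "p \<noteq> 0"
  shows "finite {t\<in>{0..<1}. poly p (cis (2 * pi * t)) = 0}" (is "finite ?Z")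
    and "card {t\<in>{0..<1}. poly p (cis (2 * pi * t)) = 0} \<le> degree p"
proof -
  have inj: "inj_on (\<lambda>t. cis (2 * pi * t)) ?Z"
    by (rule inj_on_subset[OF inj_on_cis_2pi]) auto
  have sub: "(\<lambda>t. cis (2 * pi * t)) ` ?Z \<subseteq> {z. poly p z = 0}"
    by auto
  have fin: "finite {z. poly p z = 0}"
    using assms by (rule poly_roots_finite)
  show "finite ?Z"
    using inj_on_finite[OF inj sub fin] .
  have "card ?Z \<le> card {z. poly p z = 0}"
    using card_inj_on_le[OF inj sub fin] .
  also have "\<dots> \<le> degree p"
    using assms by (rule card_poly_roots_bound)
  finally show "card ?Z \<le> degree p" .
qed

lemma Re_trig_poly_eq_poly:
  assumes A: "A \<subseteq> {- int N..int N}"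
  obtains p where "degree p \<le> 2 * N"
    and "\<And>t. poly p (cis (2 * pi * t)) = cis (2 * pi * real N * t) * of_real (2 * Re (trig_poly c A t))"
proof
  define q where "q m = monom (c m) (nat (int N + m)) + monom (cnj (c m)) (nat (int N - m))" for m
  have "finite A"
    using A by (rule finite_subset) simp
  show "degree (sum q A) \<le> 2 * N"
  proof (rule degree_sum_le[OF \<open>finite A\<close>])
    show "degree (q m) \<le> 2 * N" if "m \<in> A" for m
      unfolding q_def using subsetD[OF A that] by (intro degree_add_le order.trans[OF degree_monom_le]) auto
  qed
  fix t
  have cis_power: "cis (2 * pi * t) ^ nat (int N + l) =
      cis (2 * pi * real N * t) * cis (2 * pi * of_int l * t)"
    if "\<bar>l\<bar> \<le> int N" for l
  proof -
    have "real (nat (int N + l)) = real N + of_int l"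
      using that by linarith
    then show ?thesis
      unfolding Complex.DeMoivre cis_mult by (simp add: algebra_simps)
  qed
  have "poly (q m) (cis (2 * pi * t)) = cis (2 * pi * real N * t) *
      (c m * cis (2 * pi * of_int m * t) + cnj (c m * cis (2 * pi * of_int m * t)))" if "m \<in> A" for m
    using cis_power[of m] cis_power[of "- m"] subsetD[OF A that]
    by (simp add: abs_le_iff q_def poly_monom cis_cnj algebra_simps)
  then have "poly (sum q A) (cis (2 * pi * t)) =
      cis (2 * pi * real N * t) * (trig_poly c A t + cnj (trig_poly c A t))"
    by (simp add: poly_sum trig_poly_def sum_distrib_left sum.distrib distrib_left)
  then show "poly (sum q A) (cis (2 * pi * t)) =
      cis (2 * pi * real N * t) * of_real (2 * Re (trig_poly c A t))"
    by (simp only: complex_add_cnj)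
qed

lemma card_zeros_Re_trig_poly:
  assumes A: "A \<subseteq> {- int N..int N}" and nz: "Re (trig_poly c A t0) \<noteq> 0"
  shows "finite {t\<in>{0..<1}. Re (trig_poly c A t) = 0}"
    and "card {t\<in>{0..<1}. Re (trig_poly c A t) = 0} \<le> 2 * N"
proof -
  obtain p where deg: "degree p \<le> 2 * N"
    and p: "\<And>t. poly p (cis (2 * pi * t)) = cis (2 * pi * real N * t) * of_real (2 * Re (trig_poly c A t))"
    using Re_trig_poly_eq_poly[OF A] by blast
  have "p \<noteq> 0"
    using p[of t0] nz by auto
  have Z: "{t\<in>{0..<1}. Re (trig_poly c A t) = 0} = {t\<in>{0..<1}. poly p (cis (2 * pi * t)) = 0}"
    by (simp add: p)
  show "finite {t\<in>{0..<1}. Re (trig_poly c A t) = 0}" "card {t\<in>{0..<1}. Re (trig_poly c A t) = 0} \<le> 2 * N"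
    unfolding Z using card_poly_roots_on_circle[OF \<open>p \<noteq> 0\<close>] deg by auto
qed

lemma measure_Re_trig_poly_steep_le:
  assumes A: "A \<subseteq> {- int N..int N}" and r: "0 \<le> r" and s: "0 < s"
  shows "measure lborel
      (steep_sublevel (\<lambda>t. Re (trig_poly c A t)) (\<lambda>t. Re (trig_poly (deriv_coeff c) A t)) r s {0..1})
    \<le> (2 * real N + 1) * (2 * r / s)"
    (is "measure lborel (steep_sublevel ?g ?g' r s {0..1}) \<le> _")
proof (cases "\<forall>t. ?g' t = 0")
  case True
  then show ?thesis
    using r s by (simp add: steep_sublevel_def)
next
  case False
  then obtain t0 where "?g' t0 \<noteq> 0"
    by blast
  note zeros = card_zeros_Re_trig_poly[OF A this]
  have "measure lborel (steep_sublevel ?g ?g' r s {0..1}) \<le>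
      (real (card {t\<in>{0..<1}. ?g' t = 0}) + 1) * (2 * r / s)"
    using zeros(1) r s
    by (intro measure_steep_sublevel_le has_field_derivative_Re has_vector_derivative_trig_poly
        continuous_intros) auto
  also have "\<dots> \<le> (2 * real N + 1) * (2 * r / s)"
    using zeros(2) r s by (intro mult_right_mono) auto
  finally show ?thesis .
qed

lemma measure_trig_poly_steep_le:
  assumes A: "A \<subseteq> {- int N..int N}" and r: "0 \<le> r" and s: "0 < s"
  shows "measure lborel (steep_sublevel (trig_poly c A) (trig_poly (deriv_coeff c) A) r s {0..1})
    \<le> 4 * sqrt 2 * (2 * real N + 1) * r / s"
    (is "measure lborel ?E \<le> _")
proof -
  define R where "R c = steep_sublevel (\<lambda>t. Re (trig_poly c A t)) (\<lambda>t. Re (trig_poly (deriv_coeff c) A t))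
    r (s / sqrt 2) {0..1}" for c
  have fmeas: "R c \<in> fmeasurable lborel" for c
    unfolding R_def by (intro fmeasurable_steep_sublevel) measurable
  have measure_R: "measure lborel (R c) \<le> (2 * real N + 1) * (2 * r / (s / sqrt 2))" for c
    unfolding R_def using A r s by (intro measure_Re_trig_poly_steep_le) auto
  have Im: "R (\<lambda>m. - \<i> * c m) =
      steep_sublevel (\<lambda>t. Im (trig_poly c A t)) (\<lambda>t. Im (trig_poly (deriv_coeff c) A t))
        r (s / sqrt 2) {0..1}"
    by (simp only: R_def Im_trig_poly deriv_coeff_cmult)
  have "?E \<subseteq> R c \<union> R (\<lambda>m. - \<i> * c m)"
  proof
    fix t assume t: "t \<in> ?E"
    let ?d = "trig_poly (deriv_coeff c) A t"
    have "s / sqrt 2 \<le> \<bar>Re ?d\<bar> \<or> s / sqrt 2 \<le> \<bar>Im ?d\<bar>"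
      using t real_sqrt_sum_squares_less[of "Re ?d" s "Im ?d"]
      by (auto simp: steep_sublevel_def cmod_def not_le[symmetric])
    then show "t \<in> R c \<union> R (\<lambda>m. - \<i> * c m)"
      using t abs_Re_le_cmod[of "trig_poly c A t"] abs_Im_le_cmod[of "trig_poly c A t"]
      unfolding Im by (auto simp: R_def steep_sublevel_def)
  qed
  then have "measure lborel ?E \<le> measure lborel (R c \<union> R (\<lambda>m. - \<i> * c m))"
    using fmeas
    by (intro measure_mono_fmeasurable fmeasurable.Un fmeasurableD fmeasurable_steep_sublevel) measurable
  also have "\<dots> \<le> measure lborel (R c) + measure lborel (R (\<lambda>m. - \<i> * c m))"
    using fmeas by (intro measure_Un_le fmeasurableD)
  also have "\<dots> \<le> 2 * ((2 * real N + 1) * (2 * r / (s / sqrt 2)))"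
    using add_mono[OF measure_R measure_R] by (simp only: mult_2)
  also have "\<dots> = 4 * sqrt 2 * (2 * real N + 1) * r / s"
    by simp
  finally show ?thesis .
qed

lemma obtain_farthest_int:
  fixes A :: "int set"
  assumes A: "finite A" and j: "j \<in> A" "A \<noteq> {j}"
  obtains i where "i \<in> A" "i \<noteq> j" "\<And>m. m \<in> A \<Longrightarrow> \<bar>m - i\<bar> \<le> 2 * \<bar>j - i\<bar>"
proof -
  have "A \<noteq> {}"
    using j by auto
  then obtain i where i: "i \<in> A" "\<bar>j - i\<bar> = Max ((\<lambda>m. \<bar>j - m\<bar>) ` A)"
    using obtains_MAX[OF A] by metis
  then have far: "\<bar>j - m\<bar> \<le> \<bar>j - i\<bar>" if "m \<in> A" for m
    using A that by simp
  obtain l where "l \<in> A" "l \<noteq> j"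
    using j by auto
  then have "i \<noteq> j"
    using far[of l] by auto
  moreover have "\<bar>m - i\<bar> \<le> 2 * \<bar>j - i\<bar>" if "m \<in> A" for m
    using far[OF that] abs_triangle_ineq[of "m - j" "j - i"] by (simp add: abs_minus_commute)
  ultimately show ?thesis
    using that i by blast
qed

text \<open>
  The derivative of \<open>z\<^bsup>-i\<^esup> P\<close>, multiplied by \<open>z\<^sup>i\<close> and scaled so that the \<open>j\<close>-th coefficient of \<open>P\<close> is kept.
\<close>

definition normalized_deriv_coeff :: "int \<Rightarrow> int \<Rightarrow> (int \<Rightarrow> complex) \<Rightarrow> int \<Rightarrow> complex" where
  "normalized_deriv_coeff i j c m = of_int (m - i) / of_int (j - i) * c m"

lemma normalized_deriv_coeff_self: "i \<noteq> j \<Longrightarrow> normalized_deriv_coeff i j c j = c j"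
  by (simp add: normalized_deriv_coeff_def)

lemma trig_poly_normalized_deriv_coeff:
  assumes "finite A" "i \<in> A"
  shows "trig_poly (normalized_deriv_coeff i j c) (A - {i}) t =
    trig_poly (normalized_deriv_coeff i j c) A t"
  using assms by (simp add: trig_poly_def sum.remove normalized_deriv_coeff_def)

lemma norm_trig_poly_deriv_shift:
  assumes "i \<noteq> j"
  shows "cmod (trig_poly (deriv_coeff (\<lambda>m. c (m + i))) ((\<lambda>m. m - i) ` A) t) =
    2 * pi * \<bar>of_int (j - i)\<bar> * cmod (trig_poly (normalized_deriv_coeff i j c) A t)"
proof -
  have "deriv_coeff (\<lambda>m. c (m + i)) =
      (\<lambda>m. (2 * pi * \<i> * of_int (j - i)) * normalized_deriv_coeff i j c (m + i))"
    using assms by (simp add: deriv_coeff_def normalized_deriv_coeff_def fun_eq_iff)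
  then have "trig_poly (deriv_coeff (\<lambda>m. c (m + i))) ((\<lambda>m. m - i) ` A) t =
      (2 * pi * \<i> * of_int (j - i)) *
      (cis (- (2 * pi * of_int i * t)) * trig_poly (normalized_deriv_coeff i j c) A t)"
    by (simp only: trig_poly_cmult trig_poly_shift)
  then show ?thesis
    by (simp only: norm_mult norm_cis norm_of_real norm_of_int norm_ii) simp
qed

lemma four_sqrt_2_div_pi_le_6:
  fixes D :: real
  assumes "1 \<le> D"
  shows "4 * sqrt 2 * (4 * D + 1) / (2 * pi * D) \<le> 6"
proof -
  have "sqrt 2 \<le> 3 / 2"
    by (rule real_le_lsqrt) (simp_all add: power2_eq_square)
  then have "4 * sqrt 2 \<le> 6"
    by simp
  moreover have "2 * 3 * D \<le> 2 * pi * D"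
    using assms pi_gt3 by (intro mult_right_mono) auto
  then have "4 * D + 1 \<le> 2 * pi * D"
    using assms by linarith
  ultimately have "4 * sqrt 2 * (4 * D + 1) \<le> 6 * (2 * pi * D)"
    using assms by (intro mult_mono) auto
  then show ?thesis
    using assms by (simp add: pos_divide_le_eq)
qed

lemma measure_trig_poly_steep_normalized_le:
  assumes A: "finite A" "i \<in> A" and ij: "i \<noteq> j"
    and far: "\<And>m. m \<in> A \<Longrightarrow> \<bar>m - i\<bar> \<le> 2 * \<bar>j - i\<bar>" and r: "0 \<le> r" and s: "0 < s"
  shows "measure lborel
      (steep_sublevel (trig_poly c A) (trig_poly (normalized_deriv_coeff i j c) (A - {i})) r s {0..1})
    \<le> 6 * r / s" (is "measure lborel ?E \<le> _")
proof -
  define D where "D = nat \<bar>j - i\<bar>"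
  define B where "B = (\<lambda>m. m - i) ` A"
  define b where "b = (\<lambda>m. c (m + i))"
  have D: "1 \<le> real D" "\<bar>of_int (j - i)\<bar> = real D"
    using ij by (auto simp: D_def)
  have B: "B \<subseteq> {- int (2 * D)..int (2 * D)}"
    using far by (fastforce simp: B_def D_def abs_le_iff)
  have "cmod (trig_poly b B t) = cmod (trig_poly c A t)" for t
    by (simp add: b_def B_def trig_poly_shift norm_mult)
  moreover have "cmod (trig_poly (deriv_coeff b) B t) =
      2 * pi * real D * cmod (trig_poly (normalized_deriv_coeff i j c) (A - {i}) t)" for t
    unfolding b_def B_def norm_trig_poly_deriv_shift[OF ij] trig_poly_normalized_deriv_coeff[OF A] D ..
  ultimately have "?E =
      steep_sublevel (trig_poly b B) (trig_poly (deriv_coeff b) B) r (2 * pi * real D * s) {0..1}"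
    using D by (simp add: steep_sublevel_def)
  also have "measure lborel \<dots> \<le> 4 * sqrt 2 * (2 * real (2 * D) + 1) * r / (2 * pi * real D * s)"
    using D s by (intro measure_trig_poly_steep_le B r) auto
  also have "\<dots> = 4 * sqrt 2 * (4 * real D + 1) / (2 * pi * real D) * (r / s)"
    by (simp add: mult_ac)
  also have "\<dots> \<le> 6 * (r / s)"
    using r s by (intro mult_right_mono four_sqrt_2_div_pi_le_6 D) auto
  finally show ?thesis by simp
qed

lemma obtain_trig_poly_descent:
  assumes A: "finite A" and j: "j \<in> A" "A \<noteq> {j}"
  obtains i c' where "i \<in> A" "i \<noteq> j" "c' j = c j"
    and "\<forall>r\<ge>0. \<forall>s>0. measure lborel (trig_sublevel c A r)
      \<le> 6 * r / s + measure lborel {t\<in>{0..1}. cmod (trig_poly c' (A - {i}) t) < s}"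
proof -
  obtain i where i: "i \<in> A" "i \<noteq> j" "\<And>m. m \<in> A \<Longrightarrow> \<bar>m - i\<bar> \<le> 2 * \<bar>j - i\<bar>"
    using obtain_farthest_int[OF A j] by blast
  let ?c' = "normalized_deriv_coeff i j c"
  let ?F = "trig_poly ?c' (A - {i})"
  have "measure lborel (trig_sublevel c A r) \<le> 6 * r / s + measure lborel {t\<in>{0..1}. cmod (?F t) < s}"
    if r: "0 \<le> r" and s: "0 < s" for r s
  proof -
    let ?U = "steep_sublevel (trig_poly c A) ?F r s {0..1}"
    let ?V = "{t\<in>{0..1}. cmod (?F t) < s}"
    have U: "?U \<in> fmeasurable lborel"
      by (intro fmeasurable_steep_sublevel) measurable
    have V: "?V \<in> fmeasurable lborel"
      by (intro fmeasurable_Collect_Icc) measurable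
    have "measure lborel (trig_sublevel c A r) \<le> measure lborel (?U \<union> ?V)"
      using U V fmeasurable_trig_sublevel
      by (intro measure_mono_fmeasurable fmeasurable.Un fmeasurableD)
        (auto simp: trig_sublevel_def steep_sublevel_def)
    also have "\<dots> \<le> measure lborel ?U + measure lborel ?V"
      using U V by (intro measure_Un_le fmeasurableD)
    also have "measure lborel ?U \<le> 6 * r / s"
      using A i r s by (rule measure_trig_poly_steep_normalized_le)
    finally show ?thesis
      by simp
  qed
  then show ?thesis
    using i normalized_deriv_coeff_self[of i j c] by (intro that[of i ?c']) auto
qed

lemma measure_trig_poly_less_le:
  "measure lborel {t\<in>{0..1}. cmod (trig_poly c A t) < s} \<le> measure lborel (trig_sublevel c A s)"
  by (intro measure_mono_fmeasurable fmeasurable_trig_sublevel fmeasurableD fmeasurable_Collect_Icc)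
    (auto simp: trig_sublevel_def)

lemma measure_trig_sublevel_monomial_le:
  assumes "1 \<le> k" "c j \<noteq> 0"
  shows "measure lborel (trig_sublevel c {j} r) \<le> 6 * real k * (r / cmod (c j)) powr (1 / real k)"
proof (cases "cmod (c j) \<le> r")
  case True
  have "1 * 1 \<le> 6 * real k * (r / cmod (c j)) powr (1 / real k)"
    using True assms by (intro mult_mono ge_one_powr_ge_zero) auto
  then show ?thesis
    using measure_trig_sublevel_le_1[of c "{j}" r] by simp
next
  case False
  then show ?thesis
    by (simp add: trig_sublevel_monomial)
qed

lemma measure_trig_sublevel_card_2_le:
  assumes A: "finite A" "card A \<le> 2" and j: "j \<in> A" "c j \<noteq> 0" and r: "0 < r"
  shows "measure lborel (trig_sublevel c A r) \<le> 6 * (r / cmod (c j))"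
proof (cases "A = {j}")
  case True
  then show ?thesis
    using measure_trig_sublevel_monomial_le[of 1 c j r] j r by simp
next
  case False
  obtain i c' where i: "i \<in> A" "i \<noteq> j" "c' j = c j"
    and descent: "\<forall>r\<ge>0. \<forall>s>0. measure lborel (trig_sublevel c A r)
      \<le> 6 * r / s + measure lborel {t\<in>{0..1}. cmod (trig_poly c' (A - {i}) t) < s}"
    by (rule obtain_trig_poly_descent[OF A(1) j(1) False, of c])
  have "A - {i} = {j}"
    using i A j card_seteq[of A "{i, j}"] by auto
  then have empty: "{t\<in>{0..1}. cmod (trig_poly c' (A - {i}) t) < cmod (c j)} = {}"
    using i(3) by (auto simp: trig_poly_def norm_mult)
  show ?thesis
    using descent[rule_format, of r "cmod (c j)"] j r unfolding empty by simp
qed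

lemma divide_powr_eq_powr_inverse_Suc:
  fixes \<rho> k :: real
  assumes "0 < \<rho>" "0 < k"
  shows "\<rho> / \<rho> powr (k / (k + 1)) = \<rho> powr (1 / (k + 1))"
proof -
  have "1 - k / (k + 1) = 1 / (k + 1)"
    using assms by (simp add: field_simps)
  then show ?thesis
    using assms powr_diff[of \<rho> 1 "k / (k + 1)"] by simp
qed

lemma measure_trig_sublevel_le:
  assumes "1 \<le> k" "finite A" "card A \<le> k + 1" "j \<in> A" "c j \<noteq> 0" "0 < r"
  shows "measure lborel (trig_sublevel c A r) \<le> 6 * real k * (r / cmod (c j)) powr (1 / real k)"
  using assms
proof (induction k arbitrary: A c r rule: nat_induct_at_least)
  case (base A c r)
  then show ?case
    using measure_trig_sublevel_card_2_le[of A j c r] by simp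
next
  case (Suc k A c r)
  show ?case
  proof (cases "A = {j}")
    case True
    then show ?thesis
      using Suc.prems by (simp add: measure_trig_sublevel_monomial_le del: of_nat_Suc)
  next
    case False
    define \<rho> where "\<rho> = r / cmod (c j)"
    define s where "s = cmod (c j) * \<rho> powr (real k / (real k + 1))"
    have pos: "0 < \<rho>" "0 < s"
      using Suc.prems by (auto simp: \<rho>_def s_def)
    obtain i c' where i: "i \<in> A" "i \<noteq> j" "c' j = c j"
      and descent: "\<forall>r\<ge>0. \<forall>s>0. measure lborel (trig_sublevel c A r)
        \<le> 6 * r / s + measure lborel {t\<in>{0..1}. cmod (trig_poly c' (A - {i}) t) < s}"
      by (rule obtain_trig_poly_descent[OF Suc.prems(1,3) False, of c])
    have "r / s = \<rho> / \<rho> powr (real k / (real k + 1))"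
      by (simp add: \<rho>_def s_def)
    also have "\<dots> = \<rho> powr (1 / (real k + 1))"
      using pos Suc.hyps by (intro divide_powr_eq_powr_inverse_Suc) auto
    finally have rs: "r / s = \<rho> powr (1 / (real k + 1))" .
    have "measure lborel {t\<in>{0..1}. cmod (trig_poly c' (A - {i}) t) < s}
        \<le> measure lborel (trig_sublevel c' (A - {i}) s)"
      by (rule measure_trig_poly_less_le)
    also have "\<dots> \<le> 6 * real k * (s / cmod (c' j)) powr (1 / real k)"
      using Suc.prems i pos by (intro Suc.IH) auto
    also have "(s / cmod (c' j)) powr (1 / real k) = \<rho> powr (1 / (real k + 1))"
      using Suc.prems Suc.hyps i by (simp add: s_def powr_powr)
    finally have "measure lborel (trig_sublevel c A r) \<le>
        6 * (r / s) + 6 * real k * \<rho> powr (1 / (real k + 1))"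
      using descent[rule_format, of r s] Suc.prems pos by simp
    also have "\<dots> = 6 * real (Suc k) * \<rho> powr (1 / real (Suc k))"
      unfolding rs by (simp add: algebra_simps)
    finally show ?thesis
      by (simp add: \<rho>_def)
  qed
qed

subsection \<open>Capped powers\<close>

text \<open>
  This is \<open>min 1 ((r / x) powr p)\<close> except at \<open>x = 0\<close>, where \<open>r / 0 = 0\<close> would give \<open>0\<close> instead of \<open>1\<close>.
\<close>

definition capped_powr :: "real \<Rightarrow> real \<Rightarrow> real \<Rightarrow> real" where
  "capped_powr p r x = (if x \<le> r then 1 else (r / x) powr p)"

lemma borel_measurable_capped_powr [measurable]: "capped_powr p r \<in> borel_measurable borel"
  unfolding capped_powr_def by measurable

lemma capped_powr_nonneg: "0 \<le> capped_powr p r x"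
  by (simp add: capped_powr_def)

lemma capped_powr_le_1: "0 \<le> p \<Longrightarrow> 0 < r \<Longrightarrow> capped_powr p r x \<le> 1"
  by (auto simp: capped_powr_def intro!: powr_le1)

lemma capped_powr_le_powr:
  assumes "0 < r" "0 < x" "0 \<le> q" "q \<le> p"
  shows "capped_powr p r x \<le> (r / x) powr q"
  using assms by (auto simp: capped_powr_def intro!: ge_one_powr_ge_zero powr_mono')

lemma le_capped_powr_imp_le:
  assumes p: "0 < p" and r: "0 < r" and y: "0 < y" "y \<le> 1" and le: "y \<le> capped_powr p r x"
  shows "x \<le> r * y powr (- 1 / p)"
proof (cases "x \<le> r")
  case True
  have "y powr 0 \<le> y powr (- 1 / p)"
    using p y by (intro powr_mono') auto
  then have "r * 1 \<le> r * y powr (- 1 / p)"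
    using r y by (intro mult_left_mono) auto
  then show ?thesis
    using True by simp
next
  case False
  then have "y powr (1 / p) \<le> ((r / x) powr p) powr (1 / p)"
    using le p y by (intro powr_mono2) (auto simp: capped_powr_def)
  then have "y powr (1 / p) \<le> r / x"
    using p r False by (simp add: powr_powr)
  then show ?thesis
    using y r False by (simp add: powr_minus field_simps)
qed

lemma (in sigma_finite_measure) nn_integral_layer_cake:
  fixes Y :: "'a \<Rightarrow> real"
  assumes [measurable]: "Y \<in> borel_measurable M" and nonneg: "\<And>x. x \<in> space M \<Longrightarrow> 0 \<le> Y x"
  shows "(\<integral>\<^sup>+x. ennreal (Y x) \<partial>M) =
    (\<integral>\<^sup>+y. indicator {0<..} y * emeasure M {x \<in> space M. y \<le> Y x} \<partial>lborel)"
proof -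
  interpret P: pair_sigma_finite lborel M ..
  have "(\<integral>\<^sup>+x. ennreal (Y x) \<partial>M) = (\<integral>\<^sup>+x. (\<integral>\<^sup>+y. (if 0 < y \<and> y \<le> Y x then 1 else 0) \<partial>lborel) \<partial>M)"
  proof (rule nn_integral_cong)
    fix x assume "x \<in> space M"
    have "(\<integral>\<^sup>+y. (if 0 < y \<and> y \<le> Y x then 1 else 0) \<partial>lborel) = (\<integral>\<^sup>+y. indicator {0<..Y x} y \<partial>lborel)"
      by (intro nn_integral_cong) (auto simp: indicator_def)
    then show "ennreal (Y x) = (\<integral>\<^sup>+y. (if 0 < y \<and> y \<le> Y x then 1 else 0) \<partial>lborel)"
      using nonneg[OF \<open>x \<in> space M\<close>] by simp
  qed
  also have "\<dots> = (\<integral>\<^sup>+y. (\<integral>\<^sup>+x. (if 0 < y \<and> y \<le> Y x then 1 else 0) \<partial>M) \<partial>lborel)"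
    by (rule P.Fubini') measurable
  also have "\<dots> = (\<integral>\<^sup>+y. indicator {0<..} y * emeasure M {x \<in> space M. y \<le> Y x} \<partial>lborel)"
  proof (rule nn_integral_cong)
    fix y :: real
    have "(\<integral>\<^sup>+x. (if 0 < y \<and> y \<le> Y x then 1 else 0) \<partial>M) =
        (\<integral>\<^sup>+x. indicator {0<..} y * indicator {x \<in> space M. y \<le> Y x} x \<partial>M)"
      by (intro nn_integral_cong) (auto simp: indicator_def)
    then show "(\<integral>\<^sup>+x. (if 0 < y \<and> y \<le> Y x then 1 else 0) \<partial>M) =
        indicator {0<..} y * emeasure M {x \<in> space M. y \<le> Y x}"
      by (simp add: nn_integral_cmult)
  qed
  finally show ?thesis .
qed

lemma (in prob_space) emeasure_capped_powr_ge_le: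
  fixes X :: "'a \<Rightarrow> real"
  assumes [measurable]: "X \<in> borel_measurable M"
    and p: "0 < p" and r: "0 < r" and y: "0 < y" "y \<le> 1"
    and tail: "\<And>s. 0 < s \<Longrightarrow> prob {x \<in> space M. X x \<le> s} \<le> C * s powr q"
  shows "emeasure M {x \<in> space M. y \<le> capped_powr p r (X x)} \<le> ennreal (C * r powr q * y powr (- q / p))"
proof -
  let ?s = "r * y powr (- 1 / p)"
  have "{x \<in> space M. y \<le> capped_powr p r (X x)} \<subseteq> {x \<in> space M. X x \<le> ?s}"
    using le_capped_powr_imp_le[OF p r y] by auto
  then have "emeasure M {x \<in> space M. y \<le> capped_powr p r (X x)} \<le> ennreal (prob {x \<in> space M. X x \<le> ?s})"
    unfolding emeasure_eq_measure[symmetric] by (intro emeasure_mono) measurable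
  also have "\<dots> \<le> ennreal (C * ?s powr q)"
    using r y by (intro ennreal_leI tail) auto
  also have "C * ?s powr q = C * r powr q * y powr (- q / p)"
    using r y by (simp add: powr_mult powr_powr)
  finally show ?thesis .
qed

lemma (in prob_space) nn_integral_capped_powr_le:
  fixes X :: "'a \<Rightarrow> real"
  assumes X [measurable]: "X \<in> borel_measurable M"
    and pq: "0 \<le> q" "q < p" and r: "0 < r" and C: "0 \<le> C"
    and tail: "\<And>s. 0 < s \<Longrightarrow> prob {x \<in> space M. X x \<le> s} \<le> C * s powr q"
  shows "(\<integral>\<^sup>+x. ennreal (capped_powr p r (X x)) \<partial>M) \<le> ennreal (C * r powr q * (p / (p - q)))"
proof -
  let ?Y = "\<lambda>x. capped_powr p r (X x)"
  let ?f = "\<lambda>y. C * r powr q * y powr (- q / p)"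
  have "(\<integral>\<^sup>+x. ennreal (?Y x) \<partial>M) =
      (\<integral>\<^sup>+y. indicator {0<..} y * emeasure M {x \<in> space M. y \<le> ?Y x} \<partial>lborel)"
    by (intro nn_integral_layer_cake capped_powr_nonneg) measurable
  also have "\<dots> \<le> (\<integral>\<^sup>+y. ennreal (indicator {0..1} y * ?f y) \<partial>lborel)"
  proof (rule nn_integral_mono)
    fix y :: real
    consider "y \<le> 0" | "1 < y" | "0 < y" "y \<le> 1"
      by linarith
    then show "indicator {0<..} y * emeasure M {x \<in> space M. y \<le> ?Y x}
        \<le> ennreal (indicator {0..1} y * ?f y)"
    proof cases
      case 2
      then have "{x \<in> space M. y \<le> ?Y x} = {}"
        using pq r capped_powr_le_1[of p r] by (auto simp: not_le intro: le_less_trans)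
      then show ?thesis
        by (simp only: emeasure_empty mult_zero_right zero_le)
    next
      case 3
      then show ?thesis
        using emeasure_capped_powr_ge_le[OF X _ r 3 tail, of p] pq by simp
    qed simp
  qed
  also have "\<dots> = ennreal (C * r powr q * (p / (p - q)))"
  proof (rule nn_integral_has_integral_lebesgue)
    have "- q / p + 1 = (p - q) / p"
      using pq by (simp add: field_simps)
    then have "((\<lambda>y. y powr (- q / p)) has_integral p / (p - q)) {0..1}"
      using has_integral_powr_from_0[of "- q / p" 1] pq by simp
    then show "(?f has_integral C * r powr q * (p / (p - q))) {0..1}"
      by (rule has_integral_mult_right)
  qed (use C in auto)
  finally show ?thesis .
qed

subsection \<open>Laurent polynomials\<close>

definition exponents_in :: "nat \<Rightarrow> laurent \<Rightarrow> int set" where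
  "exponents_in i P = (\<lambda>v. Poly_Mapping.lookup v i) ` Poly_Mapping.keys P"

lemma finite_exponents_in: "finite (exponents_in i P)"
  by (simp add: exponents_in_def)

lemma keys_coeff_in:
  "w \<in> Poly_Mapping.keys (coeff_in i P m) \<longleftrightarrow>
    Poly_Mapping.lookup w i = 0 \<and> w + Poly_Mapping.single i m \<in> Poly_Mapping.keys P"
  by (simp add: in_keys_iff lookup_coeff_in)

lemma lookup_coeff_in_minus_single:
  "Poly_Mapping.lookup (coeff_in i P (Poly_Mapping.lookup v i))
      (v - Poly_Mapping.single i (Poly_Mapping.lookup v i)) =
    Poly_Mapping.lookup P v"
  by (simp add: lookup_coeff_in lookup_minus)

lemma coeff_in_eq_0_iff: "coeff_in i P m = 0 \<longleftrightarrow> m \<notin> exponents_in i P"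
proof
  assume "coeff_in i P m = 0"
  then have "v \<notin> Poly_Mapping.keys P" if "Poly_Mapping.lookup v i = m" for v
    using lookup_coeff_in_minus_single[of i P v] that by (auto simp: in_keys_iff)
  then show "m \<notin> exponents_in i P"
    by (auto simp: exponents_in_def)
next
  assume m: "m \<notin> exponents_in i P"
  have "w \<notin> Poly_Mapping.keys (coeff_in i P m)" for w
  proof
    assume "w \<in> Poly_Mapping.keys (coeff_in i P m)"
    then have "Poly_Mapping.lookup (w + Poly_Mapping.single i m) i \<in> exponents_in i P"
      unfolding exponents_in_def keys_coeff_in by blast
    then show False
      using m \<open>w \<in> _\<close> by (simp add: keys_coeff_in lookup_add)
  qed
  then show "coeff_in i P m = 0"
    by (metis ex_in_conv keys_eq_empty)
qed

lemma num_coeffs_in_eq_card: "num_coeffs_in i P = card (exponents_in i P)"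
  by (simp add: num_coeffs_in_def coeff_in_eq_0_iff)

lemma num_coeffs_eq_card: "num_coeffs P = card (Poly_Mapping.keys P)"
  by (simp add: num_coeffs_def keys.rep_eq)

lemma num_coeffs_in_coeff_in_le:
  assumes "i \<noteq> l"
  shows "num_coeffs_in i (coeff_in l P m) \<le> num_coeffs_in i P"
proof -
  have "Poly_Mapping.lookup w i \<in> exponents_in i P" if "w \<in> Poly_Mapping.keys (coeff_in l P m)" for w
    using that assms unfolding exponents_in_def
    by (intro image_eqI[of _ _ "w + Poly_Mapping.single l m"])
      (simp_all add: keys_coeff_in lookup_add lookup_single)
  then have "exponents_in i (coeff_in l P m) \<subseteq> exponents_in i P"
    by (auto simp: exponents_in_def[of i "coeff_in l P m"])
  then show ?thesis
    unfolding num_coeffs_in_eq_card by (intro card_mono finite_exponents_in)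
qed

lemma coeff_in_laurent_polys:
  assumes "P \<in> laurent_polys (Suc n)"
  shows "coeff_in n P m \<in> laurent_polys n"
proof -
  have "i < n" if w: "w \<in> Poly_Mapping.keys (coeff_in n P m)" and i: "i \<in> Poly_Mapping.keys w" for w i
  proof -
    have "Poly_Mapping.lookup w n = 0"
      using w by (simp add: keys_coeff_in)
    then have "i \<noteq> n"
      using i by (auto simp: in_keys_iff)
    then have "i \<in> Poly_Mapping.keys (w + Poly_Mapping.single n m)"
      using i by (simp add: in_keys_iff lookup_add lookup_single)
    then have "i < Suc n"
      using w assms by (auto simp: keys_coeff_in laurent_polys_def)
    then show ?thesis
      using \<open>i \<noteq> n\<close> by simp
  qed
  then show ?thesis
    by (auto simp: laurent_polys_def)
qed

lemma laurent_eval_coeff_in: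
  "laurent_eval n (coeff_in n P m) z = (\<Sum>v | v \<in> Poly_Mapping.keys P \<and> Poly_Mapping.lookup v n = m.
    Poly_Mapping.lookup P v * (\<Prod>i<n. z i powi Poly_Mapping.lookup v i))"
  unfolding laurent_eval_def
proof (rule sum.reindex_bij_witness[of _ "\<lambda>v. v - Poly_Mapping.single n m"
      "\<lambda>w. w + Poly_Mapping.single n m"])
  fix w assume w: "w \<in> Poly_Mapping.keys (coeff_in n P m)"
  then show "w + Poly_Mapping.single n m \<in> {v \<in> Poly_Mapping.keys P. Poly_Mapping.lookup v n = m}"
    by (simp add: keys_coeff_in lookup_add)
  show "Poly_Mapping.lookup P (w + Poly_Mapping.single n m) *
      (\<Prod>i<n. z i powi Poly_Mapping.lookup (w + Poly_Mapping.single n m) i) =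
      Poly_Mapping.lookup (coeff_in n P m) w * (\<Prod>i<n. z i powi Poly_Mapping.lookup w i)"
    using w by (simp add: keys_coeff_in lookup_coeff_in lookup_add lookup_single)
qed (auto simp: keys_coeff_in lookup_minus)

lemma laurent_eval_Suc:
  "laurent_eval (Suc n) P (z(n := y)) = (\<Sum>m\<in>exponents_in n P. laurent_eval n (coeff_in n P m) z * y powi m)"
proof -
  define c where "c v = Poly_Mapping.lookup P v * (\<Prod>i<n. z i powi Poly_Mapping.lookup v i)" for v
  have "laurent_eval (Suc n) P (z(n := y)) = (\<Sum>v\<in>Poly_Mapping.keys P. c v * y powi Poly_Mapping.lookup v n)"
    by (simp add: laurent_eval_def c_def mult.assoc)
  also have "\<dots> = (\<Sum>m\<in>exponents_in n P.
      \<Sum>v | v \<in> Poly_Mapping.keys P \<and> Poly_Mapping.lookup v n = m. c v * y powi Poly_Mapping.lookup v n)"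
    unfolding exponents_in_def by (rule sum.image_gen) simp
  also have "\<dots> = (\<Sum>m\<in>exponents_in n P. laurent_eval n (coeff_in n P m) z * y powi m)"
    by (simp add: laurent_eval_coeff_in c_def sum_distrib_right)
  finally show ?thesis .
qed

lemma laurent_polys_keys_eqI:
  assumes "P \<in> laurent_polys n" "u \<in> Poly_Mapping.keys P" "v \<in> Poly_Mapping.keys P"
    and "\<And>i. i < n \<Longrightarrow> Poly_Mapping.lookup u i = Poly_Mapping.lookup v i"
  shows "u = v"
proof (rule poly_mapping_eqI)
  fix i
  show "Poly_Mapping.lookup u i = Poly_Mapping.lookup v i"
  proof (cases "i < n")
    case False
    then have "i \<notin> Poly_Mapping.keys u" "i \<notin> Poly_Mapping.keys v"
      using assms(1-3) by (auto simp: laurent_polys_def)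
    then show ?thesis by (simp add: in_keys_iff)
  qed (rule assms(4))
qed

lemma laurent_eval_0:
  assumes "P \<in> laurent_polys 0" "v \<in> Poly_Mapping.keys P"
  shows "laurent_eval 0 P z = Poly_Mapping.lookup P v"
proof -
  have "u = v" if "u \<in> Poly_Mapping.keys P" for u
    using laurent_polys_keys_eqI[OF assms(1) that assms(2)] by simp
  then have "Poly_Mapping.keys P = {v}"
    using assms(2) by blast
  then show ?thesis
    by (simp add: laurent_eval_def)
qed

lemma num_coeffs_in_le_kappa: "i < n \<Longrightarrow> num_coeffs_in i P \<le> kappa n P"
  unfolding kappa_def by (intro Max_ge) auto

lemma kappa_le_num_coeffs:
  assumes "1 \<le> n"
  shows "kappa n P \<le> num_coeffs P"
proof -
  have "num_coeffs_in i P \<le> num_coeffs P" for i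
    unfolding num_coeffs_in_eq_card num_coeffs_eq_card exponents_in_def by (intro card_image_le finite_keys)
  then show ?thesis
    unfolding kappa_def using assms by (subst Max_le_iff) (auto simp: lessThan_empty_iff)
qed

lemma kappa_ge_2:
  assumes P: "P \<in> laurent_polys n" and "2 \<le> num_coeffs P"
  shows "2 \<le> kappa n P"
proof (rule ccontr)
  assume "\<not> 2 \<le> kappa n P"
  then have "card (exponents_in i P) \<le> Suc 0" if "i < n" for i
    using num_coeffs_in_le_kappa[OF that, of P] by (simp add: num_coeffs_in_eq_card)
  then have eq: "x = y" if "i < n" "x \<in> exponents_in i P" "y \<in> exponents_in i P" for i x y
    using that card_le_Suc0_iff_eq[OF finite_exponents_in] by blast
  have "u = v" if uv: "u \<in> Poly_Mapping.keys P" "v \<in> Poly_Mapping.keys P" for u v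
  proof (rule laurent_polys_keys_eqI[OF P uv])
    show "Poly_Mapping.lookup u i = Poly_Mapping.lookup v i" if "i < n" for i
      using eq[OF that] uv unfolding exponents_in_def by blast
  qed
  then have "num_coeffs P \<le> Suc 0"
    unfolding num_coeffs_eq_card card_le_Suc0_iff_eq[OF finite_keys] by blast
  then show False
    using assms by simp
qed

lemma L_inf_attained:
  assumes "P \<noteq> 0"
  obtains v where "v \<in> Poly_Mapping.keys P" "cmod (Poly_Mapping.lookup P v) = L_inf P"
proof -
  let ?R = "range (\<lambda>v. cmod (Poly_Mapping.lookup P v))"
  have "?R \<subseteq> insert 0 ((\<lambda>v. cmod (Poly_Mapping.lookup P v)) ` Poly_Mapping.keys P)"
    by (auto simp: in_keys_iff)
  then have fin: "finite ?R"
    by (rule finite_subset) simp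
  then have "L_inf P \<in> ?R"
    unfolding L_inf_def by (intro Max_in) auto
  then obtain v where v: "cmod (Poly_Mapping.lookup P v) = L_inf P"
    by auto
  obtain u where "Poly_Mapping.lookup P u \<noteq> 0"
    using assms by (metis poly_mapping_eqI lookup_zero)
  then have "0 < cmod (Poly_Mapping.lookup P u)"
    by simp
  also have "\<dots> \<le> L_inf P"
    unfolding L_inf_def using fin by (intro Max_ge) auto
  finally have "0 < cmod (Poly_Mapping.lookup P v)"
    unfolding v .
  then have "v \<in> Poly_Mapping.keys P"
    by (simp add: in_keys_iff)
  then show ?thesis
    using v by (rule that)
qed

subsection \<open>Several variables\<close>

lemma cis_powi: "cis (2 * pi * t) powi m = cis (2 * pi * of_int m * t)"
  by (simp add: cis_power_int mult_ac)

lemma sets_circle_sublevel: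
  "{z. cmod z = 1 \<and> cmod (\<Sum>m\<in>B. b m * z powi m) \<le> r} \<in> sets circle_borel"
proof -
  have [measurable]: "(\<lambda>z. z powi m) \<in> borel_measurable circle_borel" for m :: int
    by (cases "m \<ge> 0") (simp_all add: power_int_def)
  have "{z \<in> space circle_borel. cmod (\<Sum>m\<in>B. b m * z powi m) \<le> r} \<in> sets circle_borel"
    by measurable
  then show ?thesis by simp
qed

lemma measure_circle_sublevel_le:
  assumes B: "finite B" "card B \<le> K" "2 \<le> K" and j: "j \<in> B" and r: "0 < r"
  shows "measure circle_measure {z. cmod z = 1 \<and> cmod (\<Sum>m\<in>B. b m * z powi m) \<le> r}
    \<le> 6 * real K * capped_powr (1 / (real K - 1)) r (cmod (b j))" (is "measure _ ?E \<le> _")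
proof (cases "cmod (b j) \<le> r")
  case True
  interpret prob_space circle_measure
    by (rule prob_space_circle_measure)
  have "prob ?E \<le> 1"
    by (rule prob_le_1)
  also have "\<dots> \<le> 6 * real K"
    using B by simp
  finally show ?thesis
    using True by (simp add: capped_powr_def)
next
  case False
  have "measure circle_measure ?E = measure lborel {t\<in>{0..<1}. cmod (trig_poly b B t) \<le> r}"
    unfolding measure_def emeasure_circle_measure[OF sets_circle_sublevel]
    by (simp add: cis_powi trig_poly_def)
  also have "\<dots> \<le> measure lborel (trig_sublevel b B r)"
    by (intro measure_mono_fmeasurable fmeasurable_trig_sublevel) (auto simp: trig_sublevel_def)
  also have "\<dots> \<le> 6 * real (K - 1) * (r / cmod (b j)) powr (1 / real (K - 1))"
    using B j r False by (intro measure_trig_sublevel_le) auto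
  also have "\<dots> \<le> 6 * real K * (r / cmod (b j)) powr (1 / (real K - 1))"
    using B by (auto simp: of_nat_diff intro!: mult_right_mono)
  finally show ?thesis
    using False by (simp add: capped_powr_def)
qed

lemma borel_measurable_norm_laurent_eval [measurable]:
  "(\<lambda>z. cmod (laurent_eval n P z)) \<in> borel_measurable (torus_measure n)"
  unfolding borel_measurable_iff_le using sublevel_measurable[of n P] by (simp add: sublevel_def)

lemma emeasure_sublevel_Suc:
  "emeasure (torus_measure (Suc n)) (sublevel (Suc n) P r) =
    (\<integral>\<^sup>+z. emeasure circle_measure {y. cmod y = 1 \<and> cmod (laurent_eval (Suc n) P (z(n := y))) \<le> r}
      \<partial>torus_measure n)"
proof -
  interpret product_sigma_finite "\<lambda>_. circle_measure"
    by (intro product_sigma_finite.intro) (simp add: prob_space_imp_sigma_finite prob_space_circle_measure)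
  let ?E = "sublevel (Suc n) P r"
  have PiM: "torus_measure (Suc n) = PiM (insert n {..<n}) (\<lambda>_. circle_measure)"
    by (simp add: torus_measure_def lessThan_Suc)
  have "emeasure (torus_measure (Suc n)) ?E = (\<integral>\<^sup>+z. indicator ?E z \<partial>torus_measure (Suc n))"
    using sublevel_measurable by simp
  also have "\<dots> = (\<integral>\<^sup>+z. (\<integral>\<^sup>+y. indicator ?E (z(n := y)) \<partial>circle_measure) \<partial>torus_measure n)"
    unfolding PiM unfolding torus_measure_def
    using sublevel_measurable[of "Suc n"] unfolding PiM by (intro product_nn_integral_insert) auto
  also have "\<dots> = (\<integral>\<^sup>+z. emeasure circle_measure
      {y. cmod y = 1 \<and> cmod (laurent_eval (Suc n) P (z(n := y))) \<le> r} \<partial>torus_measure n)"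
  proof (rule nn_integral_cong)
    fix z assume "z \<in> space (torus_measure n)"
    then have "z(n := y) \<in> torus (Suc n) \<longleftrightarrow> cmod y = 1" for y
      by (auto simp: torus_def PiE_iff extensional_def less_Suc_eq)
    then have "indicator ?E (z(n := y)) =
        (indicator {y. cmod y = 1 \<and> cmod (laurent_eval (Suc n) P (z(n := y))) \<le> r} y :: ennreal)" for y
      by (simp add: sublevel_def indicator_def)
    then show "(\<integral>\<^sup>+y. indicator ?E (z(n := y)) \<partial>circle_measure) =
        emeasure circle_measure {y. cmod y = 1 \<and> cmod (laurent_eval (Suc n) P (z(n := y))) \<le> r}"
      unfolding laurent_eval_Suc by (simp add: sets_circle_sublevel)
  qed
  finally show ?thesis .
qed

lemma emeasure_sublevel_Suc_le:
  assumes K: "num_coeffs_in n P \<le> K" "2 \<le> K" and j: "j \<in> exponents_in n P" and r: "0 < r"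
  shows "emeasure (torus_measure (Suc n)) (sublevel (Suc n) P r) \<le> ennreal (6 * real K) *
    (\<integral>\<^sup>+z. ennreal (capped_powr (1 / (real K - 1)) r (cmod (laurent_eval n (coeff_in n P j) z)))
      \<partial>torus_measure n)"
proof -
  interpret circle: prob_space circle_measure
    by (rule prob_space_circle_measure)
  let ?h = "\<lambda>z. capped_powr (1 / (real K - 1)) r (cmod (laurent_eval n (coeff_in n P j) z))"
  have "measure circle_measure {y. cmod y = 1 \<and> cmod (laurent_eval (Suc n) P (z(n := y))) \<le> r}
      \<le> 6 * real K * ?h z" for z
    unfolding laurent_eval_Suc using finite_exponents_in K j r
    by (intro measure_circle_sublevel_le) (simp_all add: num_coeffs_in_eq_card)
  then have "emeasure (torus_measure (Suc n)) (sublevel (Suc n) P r) \<le>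
      (\<integral>\<^sup>+z. ennreal (6 * real K) * ennreal (?h z) \<partial>torus_measure n)"
    unfolding emeasure_sublevel_Suc circle.emeasure_eq_measure
    by (intro nn_integral_mono) (simp add: ennreal_leI flip: ennreal_mult')
  also have "\<dots> = ennreal (6 * real K) * (\<integral>\<^sup>+z. ennreal (?h z) \<partial>torus_measure n)"
    by (intro nn_integral_cmult) measurable
  finally show ?thesis .
qed

lemma measure_sublevel_1_le:
  assumes P: "P \<in> laurent_polys 1" and v: "v \<in> Poly_Mapping.keys P"
    and K: "num_coeffs_in 0 P \<le> K" "2 \<le> K" and r: "0 < r" and q: "0 \<le> q" "q \<le> 1 / (real K - 1)"
  shows "measure (torus_measure 1) (sublevel 1 P r) \<le>
    6 * real K * (r / cmod (Poly_Mapping.lookup P v)) powr q"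
proof -
  interpret T: prob_space "torus_measure n" for n
    by (rule prob_space_torus_measure)
  let ?w = "v - Poly_Mapping.single 0 (Poly_Mapping.lookup v 0)"
  define Q where "Q = coeff_in 0 P (Poly_Mapping.lookup v 0)"
  have Q: "Poly_Mapping.lookup Q ?w = Poly_Mapping.lookup P v"
    by (simp add: Q_def lookup_coeff_in_minus_single)
  then have "laurent_eval 0 Q z = Poly_Mapping.lookup P v" for z
    using P v laurent_eval_0[of Q ?w] coeff_in_laurent_polys[of P 0] by (simp add: Q_def in_keys_iff)
  then have "emeasure (torus_measure 1) (sublevel 1 P r) \<le> ennreal (6 * real K) *
      (\<integral>\<^sup>+z. ennreal (capped_powr (1 / (real K - 1)) r (cmod (Poly_Mapping.lookup P v))) \<partial>torus_measure 0)"
    using emeasure_sublevel_Suc_le[of 0 P K "Poly_Mapping.lookup v 0" r] K v r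
    by (simp add: Q_def exponents_in_def)
  also have "\<dots> = ennreal (6 * real K * capped_powr (1 / (real K - 1)) r (cmod (Poly_Mapping.lookup P v)))"
    using T.emeasure_space_1[of 0] by (simp add: ennreal_mult')
  also have "\<dots> \<le> ennreal (6 * real K * (r / cmod (Poly_Mapping.lookup P v)) powr q)"
    using v r q by (intro ennreal_leI mult_left_mono capped_powr_le_powr) (auto simp: in_keys_iff)
  finally show ?thesis
    by (simp add: T.emeasure_eq_measure)
qed

lemma measure_sublevel_Suc_le:
  fixes K :: nat and \<alpha> :: real
  defines "q \<equiv> (1 - \<alpha>) / (real K - 1)"
  assumes K: "num_coeffs_in n P \<le> K" "2 \<le> K" and j: "j \<in> exponents_in n P"
    and r: "0 < r" and L: "0 < L" and D: "0 \<le> D" and \<alpha>: "0 < \<alpha>" "\<alpha> \<le> 1"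
    and tail: "\<And>s. 0 < s \<Longrightarrow> measure (torus_measure n) (sublevel n (coeff_in n P j) s) \<le> D * (s / L) powr q"
  shows "measure (torus_measure (Suc n)) (sublevel (Suc n) P r) \<le> D * (6 * real K / \<alpha>) * (r / L) powr q"
proof -
  interpret T: prob_space "torus_measure d" for d
    by (rule prob_space_torus_measure)
  define Q where "Q = coeff_in n P j"
  define p where "p = 1 / (real K - 1)"
  have p: "0 < p" and q: "0 \<le> q" and diff: "p - q = \<alpha> * p"
    using K \<alpha> by (simp_all add: p_def q_def field_simps)
  then have "q < p"
    using mult_pos_pos[OF \<alpha>(1) p] by linarith
  have ratio: "p / (p - q) = 1 / \<alpha>"
    unfolding diff using p by simp
  have tail_Q: "T.prob n {z \<in> space (torus_measure n). cmod (laurent_eval n Q z) \<le> s}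
      \<le> D / L powr q * s powr q" if "0 < s" for s
    using tail[OF that] that L by (simp add: Q_def sublevel_def powr_divide)
  have "emeasure (torus_measure (Suc n)) (sublevel (Suc n) P r) \<le>
      ennreal (6 * real K) * (\<integral>\<^sup>+z. ennreal (capped_powr p r (cmod (laurent_eval n Q z))) \<partial>torus_measure n)"
    unfolding p_def Q_def using K j r by (rule emeasure_sublevel_Suc_le)
  also have "\<dots> \<le> ennreal (6 * real K) * ennreal (D / L powr q * r powr q * (p / (p - q)))"
    using q \<open>q < p\<close> r D by (intro mult_left_mono T.nn_integral_capped_powr_le tail_Q) auto
  also have "\<dots> = ennreal (D * (6 * real K / \<alpha>) * (r / L) powr q)"
    unfolding ratio using r L by (simp add: powr_divide mult_ac flip: ennreal_mult')
  finally show ?thesis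
    using D \<alpha> by (simp add: T.emeasure_eq_measure)
qed

lemma measure_sublevel_le:
  assumes "1 \<le> n" "P \<in> laurent_polys n" "v \<in> Poly_Mapping.keys P" "0 < r"
    and "\<And>i. i < n \<Longrightarrow> num_coeffs_in i P \<le> K" and K: "2 \<le> K" and \<alpha>: "0 < \<alpha>" "\<alpha> \<le> 1"
  shows "measure (torus_measure n) (sublevel n P r) \<le> 6 * real K * (6 * real K / \<alpha>) ^ (n - 1) *
    (r / cmod (Poly_Mapping.lookup P v)) powr ((1 - \<alpha>) / (real K - 1))"
  using assms(1-5)
proof (induction n arbitrary: P v r rule: nat_induct_at_least)
  case (base P v r)
  have "(1 - \<alpha>) / (real K - 1) \<le> 1 / (real K - 1)"
    using K \<alpha> by (intro divide_right_mono) auto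
  then show ?case
    using measure_sublevel_1_le[of P v K r "(1 - \<alpha>) / (real K - 1)"] base K \<alpha> by simp
next
  case (Suc n P v r)
  define L where "L = cmod (Poly_Mapping.lookup P v)"
  define q where "q = (1 - \<alpha>) / (real K - 1)"
  define D where "D = 6 * real K * (6 * real K / \<alpha>) ^ (n - 1)"
  define j where "j = Poly_Mapping.lookup v n"
  define w where "w = v - Poly_Mapping.single n j"
  have w: "Poly_Mapping.lookup (coeff_in n P j) w = Poly_Mapping.lookup P v"
    by (simp add: w_def j_def lookup_coeff_in_minus_single)
  have "num_coeffs_in i (coeff_in n P j) \<le> K" if "i < n" for i
    using num_coeffs_in_coeff_in_le[of i n P j] Suc.prems(4)[of i] that by simp
  then have tail: "measure (torus_measure n) (sublevel n (coeff_in n P j) s) \<le> D * (s / L) powr q"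
    if "0 < s" for s
    unfolding D_def q_def L_def w[symmetric] using that Suc.prems w coeff_in_laurent_polys[of P n j]
    by (intro Suc.IH) (simp_all add: in_keys_iff)
  have "measure (torus_measure (Suc n)) (sublevel (Suc n) P r) \<le> D * (6 * real K / \<alpha>) * (r / L) powr q"
    unfolding q_def
  proof (rule measure_sublevel_Suc_le[OF _ K _ _ _ _ \<alpha> tail[unfolded q_def]])
    show "0 < L" "j \<in> exponents_in n P"
      using Suc.prems by (auto simp: L_def j_def exponents_in_def in_keys_iff)
  qed (use Suc.prems \<alpha> in \<open>simp_all add: D_def\<close>)
  also have "D * (6 * real K / \<alpha>) = 6 * real K * (6 * real K / \<alpha>) ^ (Suc n - 1)"
    using Suc.hyps unfolding D_def by (cases n) simp_all
  finally show ?case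
    unfolding L_def q_def .
qed

lemma mult_power_le_C1:
  assumes "1 \<le> n" "K \<le> k" "1 \<le> k" "0 < \<alpha>"
  shows "6 * real K * (6 * real K / \<alpha>) ^ (n - 1) \<le> C1 n k * \<alpha> powi (1 - int n)"
proof -
  have powi: "\<alpha> powi (1 - int n) = 1 / \<alpha> ^ (n - 1)"
    using assms(1) by (simp add: power_int_def inverse_eq_divide nat_diff_distrib power_one_over)
  have "1 * real K \<le> (3 * real n * real k) * real k"
    using assms by (intro mult_mono) (auto simp: mult_ge1_I)
  then have "6 * real K \<le> 18 * real n * real k ^ 2"
    by (simp add: power2_eq_square mult_ac)
  then have "(6 * real K) ^ (n - 1) \<le> (18 * real n * real k ^ 2) ^ (n - 1)"
    by (rule power_mono) simp
  then have "6 * real K * (6 * real K) ^ (n - 1) \<le> 6 * real k * (18 * real n * real k ^ 2) ^ (n - 1)"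
    using assms by (intro mult_mono) auto
  then show ?thesis
    using assms by (simp add: C1_def powi power_divide divide_right_mono)
qed

theorem theorem4p5:
  fixes n k \<kappa> :: nat and P :: laurent and \<alpha> r :: real
  assumes "n \<ge> 1"
    and "P \<in> laurent_polys n"
    and "k = num_coeffs P"
    and "k \<ge> 2"
    and "\<kappa> = kappa n P"
    and "0 < \<alpha>" and "\<alpha> < 1"
    and "r > 0"
  shows "measure (torus_measure n) (sublevel n P r)
    \<le> C1 n k * \<alpha> powi (1 - int n) * (r / L_inf P) powr ((1 - \<alpha>) / (real \<kappa> - 1))"
proof -
  have "P \<noteq> 0"
    using assms(3,4) by (auto simp: num_coeffs_def)
  then obtain v where v: "v \<in> Poly_Mapping.keys P" "cmod (Poly_Mapping.lookup P v) = L_inf P"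
    by (rule L_inf_attained)
  have \<kappa>: "2 \<le> \<kappa>" "\<kappa> \<le> k"
    using assms kappa_ge_2 kappa_le_num_coeffs by auto
  have "measure (torus_measure n) (sublevel n P r) \<le>
      6 * real \<kappa> * (6 * real \<kappa> / \<alpha>) ^ (n - 1) *
      (r / cmod (Poly_Mapping.lookup P v)) powr ((1 - \<alpha>) / (real \<kappa> - 1))"
    using assms \<kappa>(1) v(1) by (intro measure_sublevel_le) (auto simp: num_coeffs_in_le_kappa)
  also have "\<dots> \<le> C1 n k * \<alpha> powi (1 - int n) *
      (r / cmod (Poly_Mapping.lookup P v)) powr ((1 - \<alpha>) / (real \<kappa> - 1))"
    using assms \<kappa>(2) by (intro mult_right_mono mult_power_le_C1) auto
  finally show ?thesis
    unfolding v(2) .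
qed

end
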